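(* Let $L\subseteq(\Sigma\times D)^*$ be a bounded data language. Then there is a session automaton $\mathcal A$ with $L(\mathcal A)=L$ if and only if there is a dMSO sentence $\phi$ with $L(\phi)=L$.
   Context: $\Sigma$ is a non-empty finite alphabet, $D$ an infinite set of data values; data words are elements of $(\Sigma\times D)^*$. Data words $(a_1,d_1)\cdots(a_n,d_n)$, $(a_1',d_1')\cdots(a_m',d_m')$ are equivalent if $n=m$, $a_i=a_i'$ and ($d_i=d_j\iff d_i'=d_j'$) for all $i,j$; a data language is a set of data words closed under this equivalence. A session of $w$ is a set $\{\mathrm{first}_w(d),\dots,\mathrm{last}_w(d)\}$ for $d$ occurring in $w$ (first and last positions carrying $d$); $w$ is $k$-bounded if every position lies in at most $k$ sessions; a data language is bounded if it consists of $k$-bounded data words for some fixed $k$. A session automaton $(S,\mathcal R,\iota,F,\Delta)$ has finite non-empty state set $S$, finite non-empty register set $\mathcal R$, initial state $\iota$, final states $F$, and finitely many transitions $(s,(a,\pi),s')$ with $a\in\Sigma$, $\pi\in\{r^\circledast,r^\uparrow:r\in\mathcal R\}$; configurations $(s,\tau,U)$ with $\tau:\mathcal R\rightharpoonup D$, $U\subseteq D$; reading $(a,d)$ on register $r$ requires $d=\tau(r)$ for $r^\uparrow$ and $d\notin U$ for $r^\circledast$, then sets $\tau(r):=d$, $U:=U\cup\{d\}$; runs start in $(\iota,\emptyset,\emptyset)$ and $L(\mathcal A)$ is the set of data words with a run ending in $F$. dMSO formulas: $\phi::=\mathrm{label}(x)=a\mid x=y\mid y=x+1\mid x\sim y\mid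 x\in X\mid\neg\phi\mid\phi\lor\phi\mid\exists x\,\phi\mid\exists X\,\phi$, with first-order variables ranging over positions $\{1,\dots,n\}$ of a data word $(a_1,d_1)\cdots(a_n,d_n)$, second-order variables over sets of positions; $\mathrm{label}(x)=a$ means $a_x=a$, $y=x+1$ is successor, $x\sim y$ means $d_x=d_y$, and the rest is standard. For a sentence $\phi$, $L(\phi)$ is the set of data words satisfying $\phi$. *)

theory Defs
  imports Main
begin

section \<open>Data words and data languages\<close>

text \<open>The alphabet is a finite type \<open>'a\<close>, the set of data values a type \<open>'d\<close>.
  Positions of a word \<open>w\<close> are counted from \<open>0\<close>, i.e. they are the \<open>i < length w\<close>.\<close>

type_synonym ('a, 'd) data_word = "('a \<times> 'd) list"

definition positions :: "('a, 'd) data_word \<Rightarrow> nat set" where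
  "positions w = {..<length w}"

definition label_at :: "('a, 'd) data_word \<Rightarrow> nat \<Rightarrow> 'a" where
  "label_at w i = fst (w ! i)"

definition data_at :: "('a, 'd) data_word \<Rightarrow> nat \<Rightarrow> 'd" where
  "data_at w i = snd (w ! i)"

definition data_equivalent :: "('a, 'd) data_word \<Rightarrow> ('a, 'd) data_word \<Rightarrow> bool" where
  "data_equivalent w v \<longleftrightarrow>
     length w = length v \<and>
     (\<forall>i \<in> positions w. label_at w i = label_at v i) \<and>
     (\<forall>i \<in> positions w. \<forall>j \<in> positions w.
        data_at w i = data_at w j \<longleftrightarrow> data_at v i = data_at v j)"

definition data_language :: "('a, 'd) data_word set \<Rightarrow> bool" where
  "data_language L \<longleftrightarrow> (\<forall>w v. w \<in> L \<longrightarrow> data_equivalent w v \<longrightarrow> v \<in> L)"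

definition first_pos :: "('a, 'd) data_word \<Rightarrow> 'd \<Rightarrow> nat" where
  "first_pos w d = Min {i \<in> positions w. data_at w i = d}"

definition last_pos :: "('a, 'd) data_word \<Rightarrow> 'd \<Rightarrow> nat" where
  "last_pos w d = Max {i \<in> positions w. data_at w i = d}"

definition sessions :: "('a, 'd) data_word \<Rightarrow> nat set set" where
  "sessions w = {{first_pos w d..last_pos w d} | d. d \<in> data_at w ` positions w}"

definition k_bounded :: "nat \<Rightarrow> ('a, 'd) data_word \<Rightarrow> bool" where
  "k_bounded k w \<longleftrightarrow> (\<forall>i \<in> positions w. card {I \<in> sessions w. i \<in> I} \<le> k)"

definition bounded_data_language :: "('a, 'd) data_word set \<Rightarrow> bool" where
  "bounded_data_language L \<longleftrightarrow> data_language L \<and> (\<exists>k. \<forall>w \<in> L. k_bounded k w)"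


section \<open>Session automata\<close>

text \<open>\<open>Fresh r\<close> stands for $r^\circledast$ and \<open>Reuse r\<close> for $r^\uparrow$.\<close>

datatype 'r reg_op = Fresh (reg: 'r) | Reuse (reg: 'r)

record ('s, 'r, 'a) session_aut =
  states :: "'s set"
  registers :: "'r set"
  initial :: 's
  finals :: "'s set"
  transitions :: "('s \<times> ('a \<times> 'r reg_op) \<times> 's) set"

definition session_automaton :: "('s, 'r, 'a) session_aut \<Rightarrow> bool" where
  "session_automaton A \<longleftrightarrow>
     finite (states A) \<and> states A \<noteq> {} \<and>
     finite (registers A) \<and> registers A \<noteq> {} \<and>
     initial A \<in> states A \<and>
     finals A \<subseteq> states A \<and>
     finite (transitions A) \<and>
     (\<forall>(s, (a, p), s') \<in> transitions A. s \<in> states A \<and> reg p \<in> registers A \<and> s' \<in> states A)"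

type_synonym ('s, 'r, 'd) config = "'s \<times> ('r \<rightharpoonup> 'd) \<times> 'd set"

fun enabled :: "('r \<rightharpoonup> 'd) \<Rightarrow> 'd set \<Rightarrow> 'r reg_op \<Rightarrow> 'd \<Rightarrow> bool" where
  "enabled t U (Fresh r) d \<longleftrightarrow> d \<notin> U"
| "enabled t U (Reuse r) d \<longleftrightarrow> t r = Some d"

fun step :: "('s, 'r, 'a) session_aut \<Rightarrow>
    ('s, 'r, 'd) config \<Rightarrow> 'a \<times> 'd \<Rightarrow> ('s, 'r, 'd) config \<Rightarrow> bool" where
  "step A (s, t, U) (a, d) (s', t', U') \<longleftrightarrow>
     (\<exists>p. (s, (a, p), s') \<in> transitions A \<and> enabled t U p d \<and>
          t' = t(reg p \<mapsto> d) \<and> U' = U \<union> {d})"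

fun run :: "('s, 'r, 'a) session_aut \<Rightarrow>
    ('s, 'r, 'd) config \<Rightarrow> ('a, 'd) data_word \<Rightarrow> ('s, 'r, 'd) config \<Rightarrow> bool" where
  "run A c [] c' \<longleftrightarrow> c' = c"
| "run A c (x # w) c' \<longleftrightarrow> (\<exists>c''. step A c x c'' \<and> run A c'' w c')"

definition aut_language :: "('s, 'r, 'a) session_aut \<Rightarrow> ('a, 'd) data_word set" where
  "aut_language A = {w. \<exists>s t U. run A (initial A, Map.empty, {}) w (s, t, U) \<and> s \<in> finals A}"


section \<open>dMSO\<close>

text \<open>First-order and second-order variables are separate sorts, each named by natural numbers.
  \<open>SuccPos x y\<close> is the atom $y = x + 1$.\<close>

datatype 'a dmso =
    Label nat 'a
  | EqPos nat nat
  | SuccPos nat nat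
  | SameData nat nat
  | Mem nat nat
  | Neg "'a dmso"
  | Disj "'a dmso" "'a dmso"
  | Ex1 nat "'a dmso"
  | Ex2 nat "'a dmso"

fun free1 :: "'a dmso \<Rightarrow> nat set" where
  "free1 (Label x a) = {x}"
| "free1 (EqPos x y) = {x, y}"
| "free1 (SuccPos x y) = {x, y}"
| "free1 (SameData x y) = {x, y}"
| "free1 (Mem x X) = {x}"
| "free1 (Neg f) = free1 f"
| "free1 (Disj f g) = free1 f \<union> free1 g"
| "free1 (Ex1 x f) = free1 f - {x}"
| "free1 (Ex2 X f) = free1 f"

fun free2 :: "'a dmso \<Rightarrow> nat set" where
  "free2 (Label x a) = {}"
| "free2 (EqPos x y) = {}"
| "free2 (SuccPos x y) = {}"
| "free2 (SameData x y) = {}"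
| "free2 (Mem x X) = {X}"
| "free2 (Neg f) = free2 f"
| "free2 (Disj f g) = free2 f \<union> free2 g"
| "free2 (Ex1 x f) = free2 f"
| "free2 (Ex2 X f) = free2 f - {X}"

definition sentence :: "'a dmso \<Rightarrow> bool" where
  "sentence f \<longleftrightarrow> free1 f = {} \<and> free2 f = {}"

fun sat :: "('a, 'd) data_word \<Rightarrow> (nat \<Rightarrow> nat) \<Rightarrow> (nat \<Rightarrow> nat set) \<Rightarrow> 'a dmso \<Rightarrow> bool" where
  "sat w v V (Label x a) \<longleftrightarrow> label_at w (v x) = a"
| "sat w v V (EqPos x y) \<longleftrightarrow> v x = v y"
| "sat w v V (SuccPos x y) \<longleftrightarrow> v y = v x + 1"
| "sat w v V (SameData x y) \<longleftrightarrow> data_at w (v x) = data_at w (v y)"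
| "sat w v V (Mem x X) \<longleftrightarrow> v x \<in> V X"
| "sat w v V (Neg f) \<longleftrightarrow> \<not> sat w v V f"
| "sat w v V (Disj f g) \<longleftrightarrow> sat w v V f \<or> sat w v V g"
| "sat w v V (Ex1 x f) \<longleftrightarrow> (\<exists>i \<in> positions w. sat w (v(x := i)) V f)"
| "sat w v V (Ex2 X f) \<longleftrightarrow> (\<exists>I. I \<subseteq> positions w \<and> sat w v (V(X := I)) f)"

text \<open>The empty word has no valuation into its positions, so valuations are unconstrained
  outside quantifiers; the truth of a sentence does not depend on them (\<open>sat_sentence\<close>).\<close>

definition dmso_language :: "'a dmso \<Rightarrow> ('a, 'd) data_word set" where
  "dmso_language f = {w. \<forall>v V. sat w v V f}"

lemma sat_cong:
  assumes "\<And>x. x \<in> free1 f \<Longrightarrow> v x = v' x" and "\<And>X. X \<in> free2 f \<Longrightarrow> V X = V' X"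
  shows "sat w v V f \<longleftrightarrow> sat w v' V' f"
  using assms
proof (induction f arbitrary: v v' V V')
  case (Disj f g)
  have "sat w v V f \<longleftrightarrow> sat w v' V' f" by (rule Disj.IH(1)) (auto simp: Disj.prems)
  moreover have "sat w v V g \<longleftrightarrow> sat w v' V' g" by (rule Disj.IH(2)) (auto simp: Disj.prems)
  ultimately show ?case by simp
next
  case (Neg f)
  have "sat w v V f \<longleftrightarrow> sat w v' V' f" by (rule Neg.IH) (auto simp: Neg.prems)
  then show ?case by simp
next
  case (Ex1 x f)
  have "sat w (v(x := i)) V f \<longleftrightarrow> sat w (v'(x := i)) V' f" for i
    by (rule Ex1.IH) (auto simp: Ex1.prems)
  then show ?case by simp
next
  case (Ex2 X f)
  have "sat w v (V(X := I)) f \<longleftrightarrow> sat w v' (V'(X := I)) f" for I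
    by (rule Ex2.IH) (auto simp: Ex2.prems)
  then show ?case by simp
qed auto

lemma sat_sentence:
  "sentence f \<Longrightarrow> sat w v V f \<longleftrightarrow> sat w v' V' f"
  by (rule sat_cong) (auto simp: sentence_def)


section \<open>Natural numbers suffice as states and registers\<close>

definition aut_image ::
  "('s \<Rightarrow> 's2) \<Rightarrow> ('r \<Rightarrow> 'r2) \<Rightarrow> ('s, 'r, 'a) session_aut \<Rightarrow> ('s2, 'r2, 'a) session_aut" where
  "aut_image f g A =
     \<lparr>states = f ` states A, registers = g ` registers A, initial = f (initial A),
      finals = f ` finals A,
      transitions = (\<lambda>(s, (a, p), s'). (f s, (a, map_reg_op g p), f s')) ` transitions A\<rparr>"

lemma session_automaton_image:
  assumes "session_automaton A"
  shows "session_automaton (aut_image f g A)"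
proof -
  have "reg (map_reg_op g p) = g (reg p)" for p by (cases p) auto
  then show ?thesis
    using assms by (auto simp: session_automaton_def aut_image_def)
qed

context
  fixes A :: "('s, 'r, 'a) session_aut" and f :: "'s \<Rightarrow> 's2" and g :: "'r \<Rightarrow> 'r2"
  assumes aut: "session_automaton A"
    and f: "inj_on f (states A)" and g: "inj_on g (registers A)"
begin

definition sim :: "('s, 'r, 'd) config \<Rightarrow> ('s2, 'r2, 'd) config \<Rightarrow> bool" where
  "sim = (\<lambda>(s, t, U) (s2, t2, U2). s \<in> states A \<and> s2 = f s \<and> U2 = U \<and>
     (\<forall>r \<in> registers A. t2 (g r) = t r))"

lemma enabled_image:
  assumes "\<forall>r \<in> registers A. t2 (g r) = t r" and "reg p \<in> registers A"
  shows "enabled t2 U (map_reg_op g p) d \<longleftrightarrow> enabled t U p d"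
  using assms by (cases p) auto

lemma upd_image:
  assumes "\<forall>r \<in> registers A. t2 (g r) = t r" and "reg p \<in> registers A"
  shows "\<forall>r \<in> registers A. (t2(reg (map_reg_op g p) \<mapsto> d)) (g r) = (t(reg p \<mapsto> d)) r"
  using assms g by (cases p) (auto dest: inj_onD)

lemma sim_step1:
  assumes "step A c x c'" and "sim c c2"
  shows "\<exists>c2'. step (aut_image f g A) c2 x c2' \<and> sim c' c2'"
proof -
  obtain s t U a d s' t' U' t2 where c: "c = (s, t, U)" "x = (a, d)" "c' = (s', t', U')"
    "c2 = (f s, t2, U)" and t2: "\<forall>r \<in> registers A. t2 (g r) = t r"
    using assms(2) by (cases c; cases x; cases c'; cases c2) (auto simp: sim_def)
  obtain p where p: "(s, (a, p), s') \<in> transitions A" "enabled t U p d"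
    "t' = t(reg p \<mapsto> d)" "U' = U \<union> {d}"
    using assms(1) c by auto
  have wf: "reg p \<in> registers A" "s' \<in> states A"
    using p(1) aut by (auto simp: session_automaton_def)
  have "(f s, (a, map_reg_op g p), f s') \<in> transitions (aut_image f g A)"
    using p(1) by (force simp: aut_image_def)
  then have "step (aut_image f g A) c2 x (f s', t2(reg (map_reg_op g p) \<mapsto> d), U')"
    using p enabled_image[OF t2 wf(1)] c by auto
  moreover have "sim c' (f s', t2(reg (map_reg_op g p) \<mapsto> d), U')"
    using upd_image[OF t2 wf(1)] wf c p by (simp add: sim_def)
  ultimately show ?thesis by blast
qed

lemma sim_step2:
  assumes "step (aut_image f g A) c2 x c2'" and "sim c c2"
  shows "\<exists>c'. step A c x c' \<and> sim c' c2'"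
proof -
  obtain s t U a d s2' t2' U' t2 where c: "c = (s, t, U)" "x = (a, d)" "c2' = (s2', t2', U')"
    "c2 = (f s, t2, U)" "s \<in> states A" and t2: "\<forall>r \<in> registers A. t2 (g r) = t r"
    using assms(2) by (cases c; cases x; cases c2'; cases c2) (auto simp: sim_def)
  obtain s0 p s' where p: "(s0, (a, p), s') \<in> transitions A" "f s0 = f s" "s2' = f s'"
    "enabled t2 U (map_reg_op g p) d"
    "t2' = t2(reg (map_reg_op g p) \<mapsto> d)" "U' = U \<union> {d}"
    using assms(1) c by (auto simp: aut_image_def)
  have wf: "s0 \<in> states A" "reg p \<in> registers A" "s' \<in> states A"
    using p(1) aut by (auto simp: session_automaton_def)
  have "s0 = s" using p(2) wf(1) c(5) f by (auto dest: inj_onD)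
  then have "step A c x (s', t(reg p \<mapsto> d), U')"
    using p enabled_image[OF t2 wf(2)] c by auto
  moreover have "sim (s', t(reg p \<mapsto> d), U') c2'"
    using upd_image[OF t2 wf(2)] wf c p by (simp add: sim_def)
  ultimately show ?thesis by blast
qed

lemma sim_run1:
  "run A c w c' \<Longrightarrow> sim c c2 \<Longrightarrow> \<exists>c2'. run (aut_image f g A) c2 w c2' \<and> sim c' c2'"
proof (induction w arbitrary: c c2)
  case (Cons x w)
  then obtain c1 where "step A c x c1" "run A c1 w c'" by auto
  with Cons sim_step1 show ?case by (metis run.simps(2))
qed auto

lemma sim_run2:
  "run (aut_image f g A) c2 w c2' \<Longrightarrow> sim c c2 \<Longrightarrow> \<exists>c'. run A c w c' \<and> sim c' c2'"
proof (induction w arbitrary: c c2)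
  case (Cons x w)
  then obtain c1 where "step (aut_image f g A) c2 x c1" "run (aut_image f g A) c1 w c2'" by auto
  with Cons sim_step2 show ?case by (metis run.simps(2))
qed auto

lemma aut_language_image:
  "(aut_language (aut_image f g A) :: ('a, 'd) data_word set) = aut_language A"
proof (intro set_eqI iffI)
  have init: "sim (initial A, Map.empty, {}) (initial (aut_image f g A), Map.empty, {})"
    using aut by (simp add: sim_def aut_image_def session_automaton_def)
  have fin: "f s \<in> finals (aut_image f g A) \<longleftrightarrow> s \<in> finals A" if "s \<in> states A" for s
    using that aut f by (auto simp: aut_image_def session_automaton_def inj_on_def)
  fix w :: "('a, 'd) data_word"
  show "w \<in> aut_language A" if "w \<in> aut_language (aut_image f g A)"
    using that sim_run2[OF _ init] fin
    by (fastforce simp: aut_language_def sim_def)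
  show "w \<in> aut_language (aut_image f g A)" if "w \<in> aut_language A"
    using that sim_run1[OF _ init] fin
    by (fastforce simp: aut_language_def sim_def)
qed

end

lemma session_automaton_nat:
  fixes A :: "('s, 'r, 'a) session_aut"
  assumes "session_automaton A"
  shows "\<exists>B :: (nat, nat, 'a) session_aut. session_automaton B \<and>
    (aut_language B :: ('a, 'd) data_word set) = aut_language A"
proof -
  obtain f :: "'s \<Rightarrow> nat" where f: "inj_on f (states A)"
    using assms finite_imp_inj_to_nat_seg by (metis session_automaton_def)
  obtain g :: "'r \<Rightarrow> nat" where g: "inj_on g (registers A)"
    using assms finite_imp_inj_to_nat_seg by (metis session_automaton_def)
  show ?thesis
    using session_automaton_image[OF assms, of f g] aut_language_image[OF assms f g] by blast
qed

end

theory Submission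
  imports Defs
begin

text \<open>A data word is realized by symbolic words that record, at every position, the label and the
  register operation. In a run of a session automaton two positions carry the same datum iff they
  use the same register and the register is not refreshed in between, so equality of data is a
  regular property of the symbolic word. By Buechi's argument the symbolic words satisfying a
  formula then form a regular language (regularity meaning finitely many left quotients), and an
  automaton for this language is a session automaton. A \<open>k\<close>-bounded data word needs only \<open>k\<close>
  registers because its sessions form an interval graph of clique number at most \<open>k\<close>, which greedy
  colouring colours with \<open>k\<close> colours. Conversely, an accepting run is
  described by one set variable per transition, since the effect of the register operations is
  determined by the order and the data of the positions.\<close>

section \<open>Languages with finitely many left quotients\<close>

definition left_quotient :: "'c list set \<Rightarrow> 'c list \<Rightarrow> 'c list set" where
  "left_quotient K u = {v. u @ v \<in> K}"

text \<open>By Myhill-Nerode this is ordinary regularity over a finite alphabet. It remains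
  meaningful over an infinite one, such as the track letters below.\<close>

definition regular :: "'c list set \<Rightarrow> bool" where
  "regular K \<longleftrightarrow> finite (range (left_quotient K))"

definition conc :: "'c list set \<Rightarrow> 'c list set \<Rightarrow> 'c list set" (infixr "\<cdot>" 75) where
  "K \<cdot> M = {u @ v | u v. u \<in> K \<and> v \<in> M}"

definition letters :: "('c \<Rightarrow> bool) \<Rightarrow> 'c list set" where
  "letters P = {[c] | c. P c}"

lemma regularI: "finite R \<Longrightarrow> (\<And>u. left_quotient K u \<in> R) \<Longrightarrow> regular K"
  unfolding regular_def by (meson finite_subset image_subsetI)

lemma regular_UNIV: "regular UNIV"
  by (rule regularI[of "{UNIV}"]) (auto simp: left_quotient_def)

lemma regular_empty: "regular {}"
  by (rule regularI[of "{{}}"]) (auto simp: left_quotient_def)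

lemma regular_compl:
  assumes "regular K" shows "regular (- K)"
proof (rule regularI)
  show "finite (uminus ` range (left_quotient K))"
    using assms by (simp add: regular_def)
  show "left_quotient (- K) u \<in> uminus ` range (left_quotient K)" for u
    by (auto simp: left_quotient_def image_iff set_eq_iff)
qed

lemma regular_Un:
  assumes "regular K" and "regular M" shows "regular (K \<union> M)"
proof (rule regularI)
  show "finite ((\<lambda>(P, Q). P \<union> Q) ` (range (left_quotient K) \<times> range (left_quotient M)))"
    using assms by (simp add: regular_def)
  show "left_quotient (K \<union> M) u
      \<in> (\<lambda>(P, Q). P \<union> Q) ` (range (left_quotient K) \<times> range (left_quotient M))" for u
    by (rule image_eqI[of _ _ "(left_quotient K u, left_quotient M u)"])
      (auto simp: left_quotient_def)
qed

lemma regular_Int: "regular K \<Longrightarrow> regular M \<Longrightarrow> regular (K \<inter> M)"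
  using regular_compl[OF regular_Un[OF regular_compl regular_compl], of K M] by simp

lemma regular_UN: "finite I \<Longrightarrow> (\<And>i. i \<in> I \<Longrightarrow> regular (K i)) \<Longrightarrow> regular (\<Union>i\<in>I. K i)"
  by (induction I rule: finite_induct) (auto intro: regular_empty regular_Un)

lemma regular_lists: "regular (lists S)"
  by (rule regularI[of "{lists S, {}}"]) (auto simp: left_quotient_def)

lemma regular_letters: "regular (letters P)"
proof (rule regularI)
  show "finite {letters P, {[]}, {}}" by simp
  show "left_quotient (letters P) u \<in> {letters P, {[]}, {}}" for u
  proof (cases u)
    case Nil
    then show ?thesis by (simp add: left_quotient_def)
  next
    case (Cons c u')
    then have "left_quotient (letters P) u = (if P c \<and> u' = [] then {[]} else {})"
      by (auto simp: left_quotient_def letters_def)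
    then show ?thesis by simp
  qed
qed

text \<open>Either \<open>u\<close> ends within the factor from \<open>K\<close>, or that factor is
  a prefix \<open>u1\<close> of \<open>u\<close> and the rest \<open>u2\<close> is read in
  \<open>M\<close>.\<close>

lemma left_quotient_conc:
  "left_quotient (K \<cdot> M) u
     = (left_quotient K u \<cdot> M) \<union> \<Union>(left_quotient M ` {u2. \<exists>u1. u = u1 @ u2 \<and> u1 \<in> K})"
  by (auto simp: left_quotient_def conc_def append_eq_append_conv2)

lemma regular_conc:
  assumes "regular K" and "regular M" shows "regular (K \<cdot> M)"
proof (rule regularI)
  \<comment> \<open>As in the subset construction, a quotient is determined by one quotient of
    \<open>K\<close> and a set of quotients of \<open>M\<close>, which leaves finitely many.\<close>
  let ?R = "(\<lambda>(P, S). (P \<cdot> M) \<union> \<Union>S) ` (range (left_quotient K) \<times> Pow (range (left_quotient M)))"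
  show "finite ?R" using assms by (simp add: regular_def)
  show "left_quotient (K \<cdot> M) u \<in> ?R" for u
    unfolding left_quotient_conc
    by (rule image_eqI[of _ _ "(left_quotient K u,
      left_quotient M ` {u2. \<exists>u1. u = u1 @ u2 \<and> u1 \<in> K})"]) auto
qed

lemma regular_vimage_map:
  assumes "regular K" shows "regular {u. map f u \<in> K}"
proof (rule regularI)
  show "finite ((\<lambda>Q. {v. map f v \<in> Q}) ` range (left_quotient K))"
    using assms by (simp add: regular_def)
  show "left_quotient {u. map f u \<in> K} u \<in> (\<lambda>Q. {v. map f v \<in> Q}) ` range (left_quotient K)" for u
    by (rule image_eqI[of _ _ "left_quotient K (map f u)"]) (auto simp: left_quotient_def)
qed

lemma left_quotient_image_map:
  "left_quotient (map f ` K) u = \<Union>((`) (map f) ` left_quotient K ` {u'. map f u' = u})"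
proof (intro set_eqI iffI)
  fix v assume "v \<in> left_quotient (map f ` K) u"
  then obtain z where z: "z \<in> K" "u @ v = map f z" by (auto simp: left_quotient_def)
  then obtain u' v' where "z = u' @ v'" "u = map f u'" "v = map f v'"
    by (metis append_eq_map_conv)
  with z show "v \<in> \<Union>((`) (map f) ` left_quotient K ` {u'. map f u' = u})"
    by (auto simp: left_quotient_def)
next
  fix v assume "v \<in> \<Union>((`) (map f) ` left_quotient K ` {u'. map f u' = u})"
  then show "v \<in> left_quotient (map f ` K) u"
    by (auto simp: left_quotient_def simp flip: map_append)
qed

text \<open>Projection, needed for the existential quantifiers. A quotient of the image is
  determined by a set of quotients of \<open>K\<close>, however many preimages the prefix
  \<open>u\<close> has.\<close>

lemma regular_image_map:
  assumes "regular K" shows "regular (map f ` K)"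
proof (rule regularI)
  let ?R = "(\<lambda>S. \<Union>((`) (map f) ` S)) ` Pow (range (left_quotient K))"
  show "finite ?R" using assms by (simp add: regular_def)
  show "left_quotient (map f ` K) u \<in> ?R" for u
    unfolding left_quotient_image_map by (rule imageI) auto
qed

lemmas regular_intros = regular_UNIV regular_compl regular_Un regular_Int regular_UN
  regular_lists regular_letters regular_conc regular_vimage_map regular_image_map

section \<open>Membership in patterns of letters and gaps\<close>

lemma mem_letters_conc:
  "u \<in> letters P \<cdot> M \<longleftrightarrow> (\<exists>c v. u = c # v \<and> P c \<and> v \<in> M)"
  unfolding conc_def letters_def by (auto intro: exI[of _ "[_]"])

lemma mem_conc_letters_conc:
  "u \<in> K \<cdot> letters P \<cdot> M \<longleftrightarrow>
    (\<exists>i < length u. take i u \<in> K \<and> P (u ! i) \<and> drop (Suc i) u \<in> M)"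
proof
  assume "u \<in> K \<cdot> letters P \<cdot> M"
  then obtain x c v where "u = x @ c # v" "x \<in> K" "P c" "v \<in> M"
    by (auto simp: conc_def letters_def)
  then show "\<exists>i < length u. take i u \<in> K \<and> P (u ! i) \<and> drop (Suc i) u \<in> M"
    by (intro exI[of _ "length x"]) auto
next
  assume "\<exists>i < length u. take i u \<in> K \<and> P (u ! i) \<and> drop (Suc i) u \<in> M"
  then obtain i where i: "i < length u" "take i u \<in> K" "P (u ! i)" "drop (Suc i) u \<in> M" by auto
  then have "u ! i # drop (Suc i) u \<in> letters P \<cdot> M" by (auto simp: mem_letters_conc)
  with i id_take_nth_drop[OF i(1)] show "u \<in> K \<cdot> letters P \<cdot> M"
    by (auto simp: conc_def[of K])
qed

lemma mem_two_letters:
  "u \<in> UNIV \<cdot> letters P \<cdot> lists S \<cdot> letters Q \<cdot> UNIV \<longleftrightarrow>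
    (\<exists>i j. i < j \<and> j < length u \<and> P (u ! i) \<and> (\<forall>m. i < m \<and> m < j \<longrightarrow> u ! m \<in> S) \<and> Q (u ! j))"
  (is "?L \<longleftrightarrow> ?R")
proof
  assume ?L
  then obtain i l where i: "i < length u" "P (u ! i)" "l < length u - Suc i"
    "set (take l (drop (Suc i) u)) \<subseteq> S" "Q (drop (Suc i) u ! l)"
    unfolding mem_conc_letters_conc lists_eq_set by auto
  have "u ! m \<in> S" if "i < m" "m < Suc i + l" for m
  proof -
    have "take l (drop (Suc i) u) ! (m - Suc i) \<in> S"
      using i(3,4) that by (intro subsetD[OF _ nth_mem]) auto
    then show ?thesis using that i by simp
  qed
  then show ?R using i by (intro exI[of _ i] exI[of _ "Suc i + l"]) auto
next
  assume ?R
  then obtain i j where i: "i < j" "j < length u" "P (u ! i)"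
    "\<forall>m. i < m \<and> m < j \<longrightarrow> u ! m \<in> S" "Q (u ! j)" by auto
  define l where "l = j - Suc i"
  have "take l (drop (Suc i) u) \<in> lists S"
    using i by (auto simp: in_set_conv_nth l_def)
  then show ?L
    unfolding mem_conc_letters_conc using i by (intro exI[of _ i] conjI exI[of _ l]) (auto simp: l_def)
qed

text \<open>The marks \<open>A\<close> and \<open>B\<close> each hold at a single position, which
  forces the two positions that the pattern leaves open.\<close>

lemma mem_two_marked_letters:
  assumes "i0 < length u" and "j0 < length u"
    and "\<And>i. i < length u \<Longrightarrow> A (u ! i) \<longleftrightarrow> i0 = i" and "\<And>i. i < length u \<Longrightarrow> B (u ! i) \<longleftrightarrow> j0 = i"
  shows "u \<in> UNIV \<cdot> letters (\<lambda>c. A c \<and> P c) \<cdot> lists S \<cdot> letters (\<lambda>c. B c \<and> Q c) \<cdot> UNIV \<longleftrightarrow>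
    i0 < j0 \<and> P (u ! i0) \<and> (\<forall>m. i0 < m \<and> m < j0 \<longrightarrow> u ! m \<in> S) \<and> Q (u ! j0)" (is "?L \<longleftrightarrow> ?R")
proof
  assume ?L
  then obtain i j where ij: "i < j" "j < length u" "A (u ! i)" "P (u ! i)"
    "\<forall>m. i < m \<and> m < j \<longrightarrow> u ! m \<in> S" "B (u ! j)" "Q (u ! j)"
    unfolding mem_two_letters by blast
  then have "i0 = i" "j0 = j" using assms(3)[of i] assms(4)[of j] by auto
  then show ?R using ij by simp
next
  assume ?R
  then show ?L unfolding mem_two_letters using assms by blast
qed

section \<open>Runs of session automata\<close>

text \<open>Register contents are read off the earlier operations and data, which makes enabledness
  expressible in dMSO.\<close>

definition op_ok :: "(nat \<Rightarrow> 'r reg_op) \<Rightarrow> ('a, 'd) data_word \<Rightarrow> nat \<Rightarrow> bool" where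
  "op_ok \<rho> w j \<longleftrightarrow> (case \<rho> j of
      Fresh r \<Rightarrow> \<forall>i<j. data_at w i \<noteq> data_at w j
    | Reuse r \<Rightarrow> \<exists>i<j. reg (\<rho> i) = r \<and> (\<forall>m. i < m \<and> m < j \<longrightarrow> reg (\<rho> m) \<noteq> r) \<and>
        data_at w i = data_at w j)"

fun reg_content :: "(nat \<Rightarrow> 'r reg_op) \<Rightarrow> ('a, 'd) data_word \<Rightarrow> nat \<Rightarrow> 'r \<rightharpoonup> 'd" where
  "reg_content \<rho> w 0 = Map.empty"
| "reg_content \<rho> w (Suc n) = (reg_content \<rho> w n)(reg (\<rho> n) \<mapsto> data_at w n)"

lemma reg_content_Some_iff:
  "reg_content \<rho> w n r = Some d \<longleftrightarrow>
    (\<exists>i<n. reg (\<rho> i) = r \<and> (\<forall>m. i < m \<and> m < n \<longrightarrow> reg (\<rho> m) \<noteq> r) \<and> data_at w i = d)"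
proof (induction n)
  case (Suc n)
  show ?case
  proof (cases "reg (\<rho> n) = r")
    case True
    then show ?thesis by (auto simp: less_Suc_eq)
  next
    case False
    then show ?thesis using Suc by (auto simp: less_Suc_eq)
  qed
qed auto

lemma reg_content_cong:
  "(\<And>i. i < n \<Longrightarrow> \<rho> i = \<rho>' i) \<Longrightarrow> reg_content \<rho> w n = reg_content \<rho>' w n"
  by (induction n) auto

lemma op_ok_iff_enabled:
  "op_ok \<rho> w j \<longleftrightarrow> enabled (reg_content \<rho> w j) (data_at w ` {..<j}) (\<rho> j) (data_at w j)"
proof -
  have "data_at w j \<notin> data_at w ` {..<j} \<longleftrightarrow> (\<forall>i<j. data_at w i \<noteq> data_at w j)"
    by (metis (no_types, lifting) image_iff lessThan_iff)
  then show ?thesis by (cases "\<rho> j") (simp_all add: op_ok_def reg_content_Some_iff)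
qed

lemma op_ok_cong:
  "(\<And>i. i \<le> j \<Longrightarrow> \<rho> i = \<rho>' i) \<Longrightarrow> op_ok \<rho> w j = op_ok \<rho>' w j"
  unfolding op_ok_iff_enabled using reg_content_cong[of j \<rho> \<rho>' w] by simp

lemma run_snoc: "run A c (w @ [x]) c' \<longleftrightarrow> (\<exists>c''. run A c w c'' \<and> step A c'' x c')"
proof (induction w arbitrary: c)
  case (Cons y w)
  show ?case unfolding append_Cons run.simps Cons.IH by blast
qed (auto simp del: step.simps split_paired_Ex)

text \<open>A run with registers and used data eliminated: both are functions of
  \<open>\<rho>\<close> and \<open>w\<close>, so only \<open>op_ok\<close> remains. The state before
  position \<open>i\<close> is \<open>\<sigma> i\<close>, hence \<open>n\<close> letters involve
  \<open>n + 1\<close> states.\<close>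

definition run_trace where
  "run_trace A \<rho> \<sigma> w n \<longleftrightarrow> \<sigma> 0 = initial A \<and>
    (\<forall>i<n. (\<sigma> i, (label_at w i, \<rho> i), \<sigma> (Suc i)) \<in> transitions A \<and> op_ok \<rho> w i)"

lemma run_iff_trace:
  assumes "n \<le> length w"
  shows "run A (initial A, Map.empty, {}) (take n w) (s, t, U) \<longleftrightarrow>
    U = data_at w ` {..<n} \<and>
    (\<exists>\<rho> \<sigma>. run_trace A \<rho> \<sigma> w n \<and> \<sigma> n = s \<and> t = reg_content \<rho> w n)"
  using assms
proof (induction n arbitrary: s t U)
  case 0
  show ?case by (auto simp: run_trace_def)
next
  case (Suc n)
  have w: "take (Suc n) w = take n w @ [(label_at w n, data_at w n)]"
    using Suc.prems by (simp add: take_Suc_conv_app_nth label_at_def data_at_def)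
  have upd: "data_at w ` {..<Suc n} = data_at w ` {..<n} \<union> {data_at w n}"
    by (auto simp: lessThan_Suc)
  show ?case (is "?L \<longleftrightarrow> ?R")
  proof
    assume ?L
    then obtain s0 t0 U0 p where 0: "run A (initial A, Map.empty, {}) (take n w) (s0, t0, U0)"
      "(s0, (label_at w n, p), s) \<in> transitions A" "enabled t0 U0 p (data_at w n)"
      "t = t0(reg p \<mapsto> data_at w n)" "U = U0 \<union> {data_at w n}"
      unfolding w run_snoc by auto
    obtain \<rho> \<sigma> where 1: "U0 = data_at w ` {..<n}" "run_trace A \<rho> \<sigma> w n" "\<sigma> n = s0"
      "t0 = reg_content \<rho> w n"
      using 0(1) Suc by auto
    \<comment> \<open>Only the operation at \<open>n\<close> and the state at \<open>Suc n\<close>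
      change. The earlier conditions survive because \<open>reg_content\<close> up to
      \<open>n\<close> and \<open>op_ok\<close> below \<open>n\<close> look only at operations
      before \<open>n\<close>.\<close>
    define \<rho>' \<sigma>' where "\<rho>' = \<rho>(n := p)" and "\<sigma>' = \<sigma>(Suc n := s)"
    have rc: "reg_content \<rho>' w n = reg_content \<rho> w n"
      by (rule reg_content_cong) (auto simp: \<rho>'_def)
    have ok: "op_ok \<rho>' w i = op_ok \<rho> w i" if "i < n" for i
      by (rule op_ok_cong) (use that in \<open>auto simp: \<rho>'_def\<close>)
    have "op_ok \<rho>' w n"
      unfolding op_ok_iff_enabled rc using 0(3) 1 by (simp add: \<rho>'_def)
    then have "run_trace A \<rho>' \<sigma>' w (Suc n)"
      using 1 0(2) ok by (auto simp: run_trace_def less_Suc_eq \<rho>'_def \<sigma>'_def)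
    moreover have "t = reg_content \<rho>' w (Suc n)"
      using 0(4) 1 rc by (simp add: \<rho>'_def)
    ultimately show ?R using 0(5) 1(1) upd by (auto simp: \<sigma>'_def intro!: exI[of _ \<rho>'] exI[of _ \<sigma>'])
  next
    assume ?R
    then obtain \<rho> \<sigma> where 1: "U = data_at w ` {..<Suc n}" "run_trace A \<rho> \<sigma> w (Suc n)"
      "\<sigma> (Suc n) = s" "t = reg_content \<rho> w (Suc n)"
      by blast
    have "run A (initial A, Map.empty, {}) (take n w) (\<sigma> n, reg_content \<rho> w n, data_at w ` {..<n})"
      using Suc.prems 1(2) by (subst Suc.IH) (auto simp: run_trace_def intro!: exI[of _ \<rho>] exI[of _ \<sigma>])
    moreover have "step A (\<sigma> n, reg_content \<rho> w n, data_at w ` {..<n})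
        (label_at w n, data_at w n) (s, t, U)"
      using 1 upd by (auto simp: run_trace_def op_ok_iff_enabled)
    ultimately show ?L unfolding w run_snoc by blast
  qed
qed

lemma aut_language_iff_trace:
  "w \<in> aut_language A \<longleftrightarrow> (\<exists>\<rho> \<sigma>. run_trace A \<rho> \<sigma> w (length w) \<and> \<sigma> (length w) \<in> finals A)"
  using run_iff_trace[of "length w" w A] by (auto simp: aut_language_def)

text \<open>Since a fresh datum has never been seen before, no datum ever moves to another register.\<close>

lemma same_data_iff:
  assumes "\<And>j. j < n \<Longrightarrow> op_ok \<rho> w j" and "i < j" and "j < n"
  shows "data_at w i = data_at w j \<longleftrightarrow>
    reg (\<rho> i) = reg (\<rho> j) \<and> (\<forall>m. i < m \<and> m \<le> j \<longrightarrow> \<rho> m \<noteq> Fresh (reg (\<rho> i)))"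
  using assms(2,3)
proof (induction j arbitrary: i rule: less_induct)
  case (less j)
  note ok = assms(1)[OF \<open>j < n\<close>, unfolded op_ok_def]
  show ?case
  proof (cases "\<rho> j")
    \<comment> \<open>Both sides fail: a fresh datum differs from all earlier ones, and
      \<open>m = j\<close> refutes the right side if the registers agree.\<close>
    case (Fresh r)
    with ok less.prems show ?thesis by auto
  next
    case (Reuse r)
    then obtain i' where i': "i' < j" "reg (\<rho> i') = r" "data_at w i' = data_at w j"
      "\<And>m. i' < m \<Longrightarrow> m < j \<Longrightarrow> reg (\<rho> m) \<noteq> r"
      using ok by auto
    have no: "\<rho> m \<noteq> Fresh r" if "i' < m" "m \<le> j" for m
      using that i'(4)[of m] Reuse by (cases "m = j") auto
    \<comment> \<open>The datum read at \<open>j\<close> was put into \<open>r\<close> at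
      \<open>i'\<close>, the last earlier use of \<open>r\<close>. For \<open>i\<close> before
      \<open>i'\<close> the claim reduces to the pair \<open>i\<close>, \<open>i'\<close>. For
      \<open>i\<close> after \<open>i'\<close> the register at \<open>i\<close> is not
      \<open>r\<close>, and by induction the data at \<open>i'\<close> and \<open>i\<close>
      differ.\<close>
    consider "i = i'" | "i < i'" | "i' < i" by linarith
    then show ?thesis
    proof cases
      case 1
      then show ?thesis using i' no Reuse by auto
    next
      case 2
      have "data_at w i = data_at w i' \<longleftrightarrow>
          reg (\<rho> i) = r \<and> (\<forall>m. i < m \<and> m \<le> i' \<longrightarrow> \<rho> m \<noteq> Fresh (reg (\<rho> i)))"
        using less.IH[OF i'(1) 2] i' less.prems by auto
      moreover have "(\<forall>m. i < m \<and> m \<le> j \<longrightarrow> \<rho> m \<noteq> Fresh r) \<longleftrightarrow>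
          (\<forall>m. i < m \<and> m \<le> i' \<longrightarrow> \<rho> m \<noteq> Fresh r)"
        using no i'(1) by (meson le_trans less_or_eq_imp_le not_le)
      ultimately show ?thesis using i'(3) Reuse by auto
    next
      case 3
      have "reg (\<rho> i) \<noteq> r" using 3 less.prems i'(4) by blast
      moreover have "data_at w i' \<noteq> data_at w i"
        using less.IH[OF less.prems(1) 3] less.prems i' calculation by auto
      ultimately show ?thesis using Reuse i' by auto
    qed
  qed
qed

section \<open>From formulas to regular languages\<close>

text \<open>A track letter extends a symbolic letter (label and register operation) by the sets of
  first-order and second-order variables that hold at the position.\<close>

type_synonym 'a track = "('a \<times> nat reg_op) \<times> nat set \<times> nat set"

abbreviation "track_op c \<equiv> snd (fst c)"
abbreviation "marks1 c \<equiv> fst (snd c)"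
abbreviation "marks2 c \<equiv> snd (snd c)"

text \<open>Letters store no data; the data are tied to the operations through \<open>op_ok\<close>.
  The marks are left unconstrained here.\<close>

definition encodes ::
  "nat \<Rightarrow> 'a track list \<Rightarrow> ('a, 'd) data_word \<Rightarrow> bool" where
  "encodes k e w \<longleftrightarrow> length e = length w \<and>
    (\<forall>i<length w. fst (fst (e ! i)) = label_at w i \<and> reg (track_op (e ! i)) < k \<and>
      op_ok (\<lambda>i. track_op (e ! i)) w i)"

text \<open>Only the tracks of the listed variables are constrained, so languages for formulas with
  different free variables combine without adjusting alphabets. A listed first-order variable marks
  exactly one position.\<close>

definition marks :: "nat set \<Rightarrow> nat set \<Rightarrow> 'a track list \<Rightarrow> (nat \<Rightarrow> nat) \<Rightarrow> (nat \<Rightarrow> nat set) \<Rightarrow> bool" where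
  "marks F1 F2 e v V \<longleftrightarrow>
    (\<forall>x\<in>F1. v x < length e \<and> (\<forall>i<length e. x \<in> marks1 (e ! i) \<longleftrightarrow> v x = i)) \<and>
    (\<forall>X\<in>F2. \<forall>i<length e. X \<in> marks2 (e ! i) \<longleftrightarrow> i \<in> V X)"

text \<open>Correctness is demanded only on legal encodings with proper marks; elsewhere
  \<open>K\<close> is arbitrary. The type argument fixes the data type, which \<open>f\<close> does
  not mention.\<close>

definition recognizable ::
  "nat \<Rightarrow> 'd itself \<Rightarrow> 'a dmso \<Rightarrow> bool" where
  "recognizable k _ f \<longleftrightarrow> (\<exists>K :: 'a track list set. regular K \<and>
    (\<forall>e (w :: ('a, 'd) data_word) v V.
      encodes k e w \<longrightarrow> marks (free1 f) (free2 f) e v V \<longrightarrow> (e \<in> K \<longleftrightarrow> sat w v V f)))"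

lemma recognizableI:
  assumes "regular K"
    and "\<And>e (w :: ('a, 'd) data_word) v V. encodes k e w \<Longrightarrow> marks (free1 f) (free2 f) e v V \<Longrightarrow>
      e \<in> K \<longleftrightarrow> sat w v V f"
  shows "recognizable k (TYPE('d)) (f :: 'a dmso)"
  using assms unfolding recognizable_def by blast

lemma encodes_cong:
  assumes "encodes k e w" and "map fst e' = map fst e"
  shows "encodes k e' w"
proof -
  have len: "length e' = length e" using assms(2) by (metis length_map)
  have fst: "fst (e' ! i) = fst (e ! i)" if "i < length w" for i
    using assms len that unfolding encodes_def by (metis nth_map)
  have "op_ok (\<lambda>i. track_op (e' ! i)) w j = op_ok (\<lambda>i. track_op (e ! i)) w j" if "j < length w" for j
    by (rule op_ok_cong) (use that fst in auto)
  then show ?thesis using assms(1) fst len by (auto simp: encodes_def)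
qed

lemma recognizable_SameData: "recognizable k TYPE('d) (SameData x y :: 'a dmso)"
proof (rule recognizableI)
  \<comment> \<open>By \<open>same_data_iff\<close>, equal data at \<open>x\<close> before
    \<open>y\<close> mean a common register \<open>r\<close> that is not refreshed after
    \<open>x\<close> up to \<open>y\<close>. The bound \<open>k\<close> on registers makes the union
    finite. The set \<open>E\<close> and the swapped \<open>S y x\<close> cover the other orders of
    the two positions.\<close>
  define S where "S = (\<lambda>x y. \<Union>r<k. UNIV \<cdot> letters (\<lambda>c :: 'a track. x \<in> marks1 c \<and> reg (track_op c) = r) \<cdot>
    lists {c. track_op c \<noteq> Fresh r} \<cdot>
    letters (\<lambda>c. y \<in> marks1 c \<and> track_op c = Reuse r) \<cdot> UNIV)"
  define E :: "'a track list set" where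
    "E = UNIV \<cdot> letters (\<lambda>c. x \<in> marks1 c \<and> y \<in> marks1 c) \<cdot> UNIV"
  show "regular (E \<union> S x y \<union> S y x)"
    unfolding E_def S_def by (intro regular_intros) auto
  fix e :: "'a track list" and w :: "('a, 'd) data_word" and v V
  assume enc: "encodes k e w" and "marks (free1 (SameData x y :: 'a dmso)) (free2 (SameData x y :: 'a dmso)) e v V"
  then have marks: "v x < length e" "v y < length e"
    "\<And>i. i < length e \<Longrightarrow> x \<in> marks1 (e ! i) \<longleftrightarrow> v x = i"
    "\<And>i. i < length e \<Longrightarrow> y \<in> marks1 (e ! i) \<longleftrightarrow> v y = i"
    by (auto simp: marks_def)
  have len: "length e = length w" using enc by (simp add: encodes_def)
  have ok: "op_ok (\<lambda>i. track_op (e ! i)) w j" "reg (track_op (e ! j)) < k" if "j < length e" for j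
    using enc that by (auto simp: encodes_def)
  have E: "e \<in> E \<longleftrightarrow> v x = v y"
    using marks by (auto simp: E_def mem_conc_letters_conc)
  have S: "e \<in> S a b \<longleftrightarrow> v a < v b \<and> data_at w (v a) = data_at w (v b)"
    if ab: "v a < length e" "v b < length e"
      "\<And>i. i < length e \<Longrightarrow> a \<in> marks1 (e ! i) \<longleftrightarrow> v a = i"
      "\<And>i. i < length e \<Longrightarrow> b \<in> marks1 (e ! i) \<longleftrightarrow> v b = i" for a b
  proof -
    have "e \<in> S a b \<longleftrightarrow> (\<exists>r<k. v a < v b \<and> reg (track_op (e ! v a)) = r \<and>
        (\<forall>m. v a < m \<and> m < v b \<longrightarrow> track_op (e ! m) \<noteq> Fresh r) \<and> track_op (e ! v b) = Reuse r)"
      unfolding S_def UN_iff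
      by (subst mem_two_marked_letters[of "v a" e "v b"]) (use ab in auto)
    also have "\<dots> \<longleftrightarrow> v a < v b \<and> data_at w (v a) = data_at w (v b)"
    proof (cases "v a < v b")
      case True
      \<comment> \<open>The pattern tests the later position separately from the gap: there, using
        the same register without refreshing it amounts to \<open>Reuse\<close>.\<close>
      have *: "track_op (e ! v b) = Reuse (reg (track_op (e ! v a))) \<longleftrightarrow>
          reg (track_op (e ! v a)) = reg (track_op (e ! v b)) \<and>
          track_op (e ! v b) \<noteq> Fresh (reg (track_op (e ! v a)))"
        by (cases "track_op (e ! v b)") auto
      show ?thesis
        unfolding same_data_iff[OF ok(1) True ab(2), simplified]
        using ok(2)[OF ab(1)] * True by (auto simp: le_less)
    qed auto
    finally show ?thesis .
  qed
  show "e \<in> E \<union> S x y \<union> S y x \<longleftrightarrow> sat w v V (SameData x y)"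
    using E S[of x y] S[of y x] marks by (auto simp: not_less_iff_gr_or_eq)
qed

lemma recognizable:
  "recognizable k TYPE('d) (f :: 'a dmso)"
proof (induction f)
  case (Label x a)
  show ?case
  proof (rule recognizableI[of "UNIV \<cdot> letters (\<lambda>c. x \<in> marks1 c \<and> fst (fst c) = a) \<cdot> UNIV"])
  qed (intro regular_intros, auto simp: mem_conc_letters_conc encodes_def marks_def)
next
  case (EqPos x y)
  show ?case
  proof (rule recognizableI[of "UNIV \<cdot> letters (\<lambda>c. x \<in> marks1 c \<and> y \<in> marks1 c) \<cdot> UNIV"])
  qed (intro regular_intros, auto simp: mem_conc_letters_conc encodes_def marks_def)
next
  case (SuccPos x y)
  show ?case
  \<comment> \<open>\<open>lists {}\<close> contains only the empty word, which makes the two marked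
    letters adjacent.\<close>
  proof (rule recognizableI[of "UNIV \<cdot> letters (\<lambda>c. x \<in> marks1 c) \<cdot> lists {} \<cdot>
      letters (\<lambda>c. y \<in> marks1 c) \<cdot> UNIV"])
    fix e :: "'a track list" and w :: "('a, 'd) data_word" and v V
    assume "encodes k e w"
      and "marks (free1 (SuccPos x y :: 'a dmso)) (free2 (SuccPos x y :: 'a dmso)) e v V"
    then have marks: "v x < length e" "v y < length e"
      "\<And>i. i < length e \<Longrightarrow> x \<in> marks1 (e ! i) \<longleftrightarrow> v x = i"
      "\<And>i. i < length e \<Longrightarrow> y \<in> marks1 (e ! i) \<longleftrightarrow> v y = i"
      by (auto simp: marks_def)
    have "v x < v y \<and> (\<forall>m. \<not> (v x < m \<and> m < v y)) \<longleftrightarrow> v y = v x + 1"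
      by (metis Suc_eq_plus1 Suc_lessI lessI not_less_eq)
    with mem_two_marked_letters[of "v x" e "v y" "\<lambda>c. x \<in> marks1 c" "\<lambda>c. y \<in> marks1 c"
        "\<lambda>_. True" "{}" "\<lambda>_. True"] marks
    show "e \<in> UNIV \<cdot> letters (\<lambda>c. x \<in> marks1 c) \<cdot> lists {} \<cdot>
        letters (\<lambda>c. y \<in> marks1 c) \<cdot> UNIV \<longleftrightarrow> sat w v V (SuccPos x y)"
      by simp
  qed (intro regular_intros)
next
  case (SameData x y)
  show ?case by (rule recognizable_SameData)
next
  case (Mem x X)
  show ?case
  proof (rule recognizableI[of "UNIV \<cdot> letters (\<lambda>c. x \<in> marks1 c \<and> X \<in> marks2 c) \<cdot> UNIV"])
  qed (intro regular_intros, auto simp: mem_conc_letters_conc encodes_def marks_def)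
next
  case (Neg f)
  then obtain K where K: "regular K" "\<And>e (w :: ('a, 'd) data_word) v V. encodes k e w \<Longrightarrow>
    marks (free1 f) (free2 f) e v V \<Longrightarrow> e \<in> K \<longleftrightarrow> sat w v V f"
    unfolding recognizable_def by blast
  show ?case
    \<comment> \<open>The complement also gains ill-formed words, about which
      \<open>recognizable\<close> demands nothing.\<close>
    by (rule recognizableI[OF regular_compl[OF K(1)]]) (use K(2) in auto)
next
  case (Disj f g)
  then obtain K M where K: "regular K" "\<And>e (w :: ('a, 'd) data_word) v V. encodes k e w \<Longrightarrow>
      marks (free1 f) (free2 f) e v V \<Longrightarrow> e \<in> K \<longleftrightarrow> sat w v V f"
    and M: "regular M" "\<And>e (w :: ('a, 'd) data_word) v V. encodes k e w \<Longrightarrow>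
      marks (free1 g) (free2 g) e v V \<Longrightarrow> e \<in> M \<longleftrightarrow> sat w v V g"
    unfolding recognizable_def by blast
  show ?case
  proof (rule recognizableI[OF regular_Un[OF K(1) M(1)]])
    fix e :: "'a track list" and w :: "('a, 'd) data_word" and v V
    assume e: "encodes k e w" "marks (free1 (Disj f g)) (free2 (Disj f g)) e v V"
    then have "marks (free1 f) (free2 f) e v V" "marks (free1 g) (free2 g) e v V"
      by (auto simp: marks_def)
    then show "e \<in> K \<union> M \<longleftrightarrow> sat w v V (Disj f g)" using K(2) M(2) e by auto
  qed
next
  case (Ex1 x f)
  then obtain K where K: "regular K" "\<And>e (w :: ('a, 'd) data_word) v V. encodes k e w \<Longrightarrow>
    marks (free1 f) (free2 f) e v V \<Longrightarrow> e \<in> K \<longleftrightarrow> sat w v V f"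
    unfolding recognizable_def by blast
  \<comment> \<open>The language for \<open>Ex1 x f\<close> consists of the words that land in
    \<open>K\<close> and in \<open>U\<close> after some change of their \<open>x\<close> track.
    \<open>U\<close> forces that track to mark a single position. Taking the preimage of the image
    ignores what the track held before.\<close>
  define erase :: "'a track \<Rightarrow> 'a track" where "erase = (\<lambda>(c, A, B). (c, A - {x}, B))"
  define U :: "'a track list set" where
    "U = lists {c. x \<notin> marks1 c} \<cdot> letters (\<lambda>c. x \<in> marks1 c) \<cdot> lists {c. x \<notin> marks1 c}"
  have erase: "fst (erase c) = fst c" "marks1 (erase c) = marks1 c - {x}" "marks2 (erase c) = marks2 c" for c
    by (simp_all add: erase_def split_beta)
  have U: "e \<in> U \<longleftrightarrow> (\<exists>i<length e. \<forall>j<length e. x \<in> marks1 (e ! j) \<longleftrightarrow> j = i)" for e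
  proof -
    have "(take i e \<in> lists {c. x \<notin> marks1 c} \<and> x \<in> marks1 (e ! i) \<and>
        drop (Suc i) e \<in> lists {c. x \<notin> marks1 c}) \<longleftrightarrow>
        (\<forall>j<length e. x \<in> marks1 (e ! j) \<longleftrightarrow> j = i)" (is "?L \<longleftrightarrow> ?R") if i: "i < length e" for i
    proof
      assume L: ?L
      have "x \<notin> marks1 (e ! j)" if "j < i" for j
      proof -
        have "take i e ! j \<in> {c. x \<notin> marks1 c}"
          using L i that by (intro subsetD[OF _ nth_mem]) auto
        then show ?thesis using that by simp
      qed
      moreover have "x \<notin> marks1 (e ! j)" if "i < j" "j < length e" for j
      proof -
        have "drop (Suc i) e ! (j - Suc i) \<in> {c. x \<notin> marks1 c}"
          using L i that by (intro subsetD[OF _ nth_mem]) auto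
        then show ?thesis using that by simp
      qed
      ultimately show ?R using L by (metis nat_neq_iff)
    next
      assume ?R
      then show ?L using i by (simp add: in_lists_conv_set all_set_conv_all_nth)
    qed
    then show ?thesis unfolding U_def mem_conc_letters_conc by blast
  qed
  show ?case
  proof (rule recognizableI)
    show "regular {e. map erase e \<in> map erase ` (K \<inter> U)}"
      unfolding U_def by (intro regular_intros K(1))
    fix e :: "'a track list" and w :: "('a, 'd) data_word" and v V
    assume enc: "encodes k e w" and mk: "marks (free1 (Ex1 x f)) (free2 (Ex1 x f)) e v V"
    have len: "length e = length w" using enc by (simp add: encodes_def)
    have enc': "encodes k e' w" if "map erase e' = map erase e" for e'
    proof (rule encodes_cong[OF enc])
      have "map fst (map erase e') = map fst (map erase e)" using that by simp
      then show "map fst e' = map fst e" by (simp add: erase comp_def)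
    qed
    have mk': "marks (free1 f) (free2 f) e' (v(x := i)) V"
      if eq: "map erase e' = map erase e" and "i < length e"
        and i: "\<And>j. j < length e \<Longrightarrow> x \<in> marks1 (e' ! j) \<longleftrightarrow> j = i" for e' i
    proof -
      have len': "length e' = length e" using eq by (metis length_map)
      have nth: "erase (e' ! j) = erase (e ! j)" if "j < length e" for j
        using eq len' that by (metis nth_map)
      have m: "marks1 (e' ! j) - {x} = marks1 (e ! j) - {x}" "marks2 (e' ! j) = marks2 (e ! j)"
        if "j < length e" for j
        using arg_cong[OF nth[OF that], of "\<lambda>c. marks1 c"] arg_cong[OF nth[OF that], of "\<lambda>c. marks2 c"]
        by (simp_all add: erase)
      have mk1: "v y < length e" "\<And>j. j < length e \<Longrightarrow> y \<in> marks1 (e ! j) \<longleftrightarrow> v y = j"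
        if "y \<in> free1 f" "y \<noteq> x" for y
        using mk that by (simp_all add: marks_def)
      have mk2: "Y \<in> marks2 (e ! j) \<longleftrightarrow> j \<in> V Y" if "Y \<in> free2 f" "j < length e" for Y j
        using mk that by (simp add: marks_def)
      have m1: "y \<in> marks1 (e' ! j) \<longleftrightarrow> y \<in> marks1 (e ! j)" if "y \<noteq> x" "j < length e" for y j
        using m(1)[OF that(2)] that(1) by blast
      show ?thesis
        unfolding marks_def len'
      proof (intro conjI ballI)
        fix y assume y: "y \<in> free1 f"
        show "(v(x := i)) y < length e" using \<open>i < length e\<close> mk1(1) y by simp
        show "\<forall>j<length e. y \<in> marks1 (e' ! j) \<longleftrightarrow> (v(x := i)) y = j"
          using i m1 mk1(2) y by (cases "y = x") auto
      qed (simp add: m mk2)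
    qed
    show "e \<in> {e. map erase e \<in> map erase ` (K \<inter> U)} \<longleftrightarrow> sat w v V (Ex1 x f)"
    proof
      assume "e \<in> {e. map erase e \<in> map erase ` (K \<inter> U)}"
      then obtain e' where e': "map erase e' = map erase e" "e' \<in> K" "e' \<in> U" by force
      have "length e' = length e" using e'(1) by (metis length_map)
      with U[of e'] e'(3) obtain i where "i < length e"
        "\<And>j. j < length e \<Longrightarrow> x \<in> marks1 (e' ! j) \<longleftrightarrow> j = i" by auto
      then have "sat w (v(x := i)) V f" "i < length w"
        using K(2)[OF enc' mk'] e' len by auto
      then show "sat w v V (Ex1 x f)" by (auto simp: positions_def)
    next
      assume "sat w v V (Ex1 x f)"
      then obtain i where i: "i < length e" "sat w (v(x := i)) V f"
        by (auto simp: positions_def len)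
      \<comment> \<open>The \<open>x\<close> track is overwritten so that it marks the witness
        \<open>i\<close> and nothing else.\<close>
      define e' where "e' = map (\<lambda>j. (fst (e ! j),
        (if j = i then insert x (marks1 (e ! j)) else marks1 (e ! j) - {x}), marks2 (e ! j))) [0..<length e]"
      have eq: "map erase e' = map erase e"
        by (rule nth_equalityI) (auto simp: e'_def erase_def split_beta)
      have x: "x \<in> marks1 (e' ! j) \<longleftrightarrow> j = i" if "j < length e" for j
        using that by (auto simp: e'_def)
      have "e' \<in> K" using K(2)[OF enc' mk', OF eq eq i(1)] x i(2) by blast
      moreover have "e' \<in> U" unfolding U using i(1) x by (auto simp: e'_def)
      ultimately show "e \<in> {e. map erase e \<in> map erase ` (K \<inter> U)}"
        using eq by (auto intro!: image_eqI[of _ _ e'])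
    qed
  qed
next
  case (Ex2 X f)
  then obtain K where K: "regular K" "\<And>e (w :: ('a, 'd) data_word) v V. encodes k e w \<Longrightarrow>
    marks (free1 f) (free2 f) e v V \<Longrightarrow> e \<in> K \<longleftrightarrow> sat w v V f"
    unfolding recognizable_def by blast
  \<comment> \<open>As for \<open>Ex1\<close>, but no analogue of \<open>U\<close> is imposed, since
    every content of a second-order track denotes a set of positions.\<close>
  define erase :: "'a track \<Rightarrow> 'a track" where "erase = (\<lambda>(c, A, B). (c, A, B - {X}))"
  have erase: "fst (erase c) = fst c" "marks1 (erase c) = marks1 c" "marks2 (erase c) = marks2 c - {X}" for c
    by (simp_all add: erase_def split_beta)
  show ?case
  proof (rule recognizableI)
    show "regular {e. map erase e \<in> map erase ` K}"
      by (intro regular_intros K(1))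
    fix e :: "'a track list" and w :: "('a, 'd) data_word" and v V
    assume enc: "encodes k e w" and mk: "marks (free1 (Ex2 X f)) (free2 (Ex2 X f)) e v V"
    have len: "length e = length w" using enc by (simp add: encodes_def)
    have enc': "encodes k e' w" if "map erase e' = map erase e" for e'
    proof (rule encodes_cong[OF enc])
      have "map fst (map erase e') = map fst (map erase e)" using that by simp
      then show "map fst e' = map fst e" by (simp add: erase comp_def)
    qed
    have mk': "marks (free1 f) (free2 f) e' v (V(X := I))"
      if eq: "map erase e' = map erase e"
        and I: "\<And>j. j < length e \<Longrightarrow> X \<in> marks2 (e' ! j) \<longleftrightarrow> j \<in> I" for e' I
    proof -
      have len': "length e' = length e" using eq by (metis length_map)
      have nth: "erase (e' ! j) = erase (e ! j)" if "j < length e" for j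
        using eq len' that by (metis nth_map)
      have m: "marks1 (e' ! j) = marks1 (e ! j)" "marks2 (e' ! j) - {X} = marks2 (e ! j) - {X}"
        if "j < length e" for j
        using arg_cong[OF nth[OF that], of "\<lambda>c. marks1 c"] arg_cong[OF nth[OF that], of "\<lambda>c. marks2 c"]
        by (simp_all add: erase)
      have mk2: "Y \<in> marks2 (e ! j) \<longleftrightarrow> j \<in> V Y" if "Y \<in> free2 f" "Y \<noteq> X" "j < length e" for Y j
        using mk that by (simp add: marks_def)
      have m2: "Y \<in> marks2 (e' ! j) \<longleftrightarrow> Y \<in> marks2 (e ! j)" if "Y \<noteq> X" "j < length e" for Y j
        using m(2)[OF that(2)] that(1) by blast
      show ?thesis
        unfolding marks_def len'
      proof (intro conjI ballI)
        fix Y assume Y: "Y \<in> free2 f"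
        show "\<forall>j<length e. Y \<in> marks2 (e' ! j) \<longleftrightarrow> j \<in> (V(X := I)) Y"
          using I m2 mk2 Y by (cases "Y = X") auto
      qed (use mk m in \<open>simp_all add: marks_def\<close>)
    qed
    show "e \<in> {e. map erase e \<in> map erase ` K} \<longleftrightarrow> sat w v V (Ex2 X f)"
    proof
      assume "e \<in> {e. map erase e \<in> map erase ` K}"
      then obtain e' where e': "map erase e' = map erase e" "e' \<in> K" by force
      define I where "I = {j. j < length e \<and> X \<in> marks2 (e' ! j)}"
      have "sat w v (V(X := I)) f"
        using K(2)[OF enc' mk'[of _ I]] e' by (auto simp: I_def)
      moreover have "I \<subseteq> positions w" by (auto simp: I_def positions_def len)
      ultimately show "sat w v V (Ex2 X f)" by auto
    next
      assume "sat w v V (Ex2 X f)"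
      then obtain I where I: "sat w v (V(X := I)) f" by auto
      define e' where "e' = map (\<lambda>j. (fst (e ! j), marks1 (e ! j),
        (if j \<in> I then insert X (marks2 (e ! j)) else marks2 (e ! j) - {X}))) [0..<length e]"
      have eq: "map erase e' = map erase e"
        by (rule nth_equalityI) (auto simp: e'_def erase_def split_beta)
      have "e' \<in> K" using K(2)[OF enc' mk', OF eq eq, of I] I by (auto simp: e'_def)
      then show "e \<in> {e. map erase e \<in> map erase ` K}"
        using eq by (auto intro!: image_eqI[of _ _ e'])
    qed
  qed
qed

section \<open>Register assignments for bounded data words\<close>

context
  fixes w :: "('a, 'd) data_word"
begin

abbreviation "data_set \<equiv> data_at w ` positions w"

lemma data_at_first_pos:
  assumes "d \<in> data_set"
  shows "first_pos w d < length w" "data_at w (first_pos w d) = d"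
proof -
  have "first_pos w d \<in> {i \<in> positions w. data_at w i = d}"
    unfolding first_pos_def by (rule Min_in) (use assms in \<open>auto simp: positions_def\<close>)
  then show "first_pos w d < length w" "data_at w (first_pos w d) = d"
    by (auto simp: positions_def)
qed

lemma first_pos_le: "i < length w \<Longrightarrow> first_pos w (data_at w i) \<le> i"
  unfolding first_pos_def by (rule Min_le) (auto simp: positions_def)

lemma le_last_pos: "i < length w \<Longrightarrow> i \<le> last_pos w (data_at w i)"
  unfolding last_pos_def by (rule Max_ge) (auto simp: positions_def)

lemma first_pos_le_last_pos: "d \<in> data_set \<Longrightarrow> first_pos w d \<le> last_pos w d"
  using data_at_first_pos le_last_pos by metis

text \<open>The left end of a session determines its datum, so counting sessions through
  \<open>n\<close> is counting data.\<close>

lemma card_open_data: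
  assumes "k_bounded k w" and "n < length w"
  shows "card {d \<in> data_set. first_pos w d \<le> n \<and> n \<le> last_pos w d} \<le> k"
proof -
  let ?S = "\<lambda>d. {first_pos w d..last_pos w d}"
  have "{I \<in> sessions w. n \<in> I} = ?S ` {d \<in> data_set. first_pos w d \<le> n \<and> n \<le> last_pos w d}"
    by (auto simp: sessions_def)
  moreover have "inj_on ?S data_set"
    using data_at_first_pos first_pos_le_last_pos by (intro inj_onI) (metis Icc_eq_Icc)
  then have "inj_on ?S {d \<in> data_set. first_pos w d \<le> n \<and> n \<le> last_pos w d}"
    by (rule inj_on_subset) auto
  then have "card (?S ` {d \<in> data_set. first_pos w d \<le> n \<and> n \<le> last_pos w d})
      = card {d \<in> data_set. first_pos w d \<le> n \<and> n \<le> last_pos w d}"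
    by (rule card_image)
  moreover have "card {I \<in> sessions w. n \<in> I} \<le> k"
    using assms by (simp add: k_bounded_def positions_def)
  ultimately show ?thesis by argo
qed

text \<open>Greedy colouring of the session intervals in order of their left ends; \<open>n\<close>
  bounds the left ends treated so far.\<close>

lemma exists_colouring:
  assumes k: "k_bounded k w" and "n \<le> length w"
  shows "\<exists>g :: 'd \<Rightarrow> nat. \<forall>d\<in>data_set. first_pos w d < n \<longrightarrow> g d < k \<and>
    (\<forall>d'\<in>data_set. first_pos w d' < n \<longrightarrow> d \<noteq> d' \<longrightarrow>
      first_pos w d \<le> last_pos w d' \<longrightarrow> first_pos w d' \<le> last_pos w d \<longrightarrow> g d \<noteq> g d')"
  using assms(2)
proof (induction n)
  case (Suc n)
  then obtain g where g: "\<And>d. d \<in> data_set \<Longrightarrow> first_pos w d < n \<Longrightarrow> g d < k"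
    "\<And>d d'. d \<in> data_set \<Longrightarrow> first_pos w d < n \<Longrightarrow> d' \<in> data_set \<Longrightarrow> first_pos w d' < n \<Longrightarrow>
      d \<noteq> d' \<Longrightarrow> first_pos w d \<le> last_pos w d' \<Longrightarrow> first_pos w d' \<le> last_pos w d \<Longrightarrow> g d \<noteq> g d'"
    by (metis Suc_leD)
  define d where "d = data_at w n"
  have d: "d \<in> data_set" using Suc.prems by (auto simp: d_def positions_def)
  have uniq: "d' = d" if "d' \<in> data_set" "first_pos w d' = n" for d'
    using data_at_first_pos(2)[OF that(1)] that(2) by (simp add: d_def)
  show ?case
  proof (cases "first_pos w d = n")
    case False
    then have "first_pos w d' < Suc n \<longleftrightarrow> first_pos w d' < n" if "d' \<in> data_set" for d'
      using uniq[OF that] by (auto simp: less_Suc_eq)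
    with g show ?thesis by (intro exI[of _ g]) auto
  next
    case True
    \<comment> \<open>These are the data whose sessions contain \<open>n\<close>, at most
      \<open>k\<close> many. Since \<open>d\<close> is one of them, the others block fewer than
      \<open>k\<close> colours and some \<open>c < k\<close> is free.\<close>
    define Op where "Op = {d \<in> data_set. first_pos w d \<le> n \<and> n \<le> last_pos w d}"
    have fin: "finite Op" by (simp add: Op_def positions_def)
    have "d \<in> Op" using d True first_pos_le_last_pos by (auto simp: Op_def)
    then have "card (Op - {d}) < card Op" using fin by (intro psubset_card_mono) auto
    moreover have "card Op \<le> k"
      using card_open_data[OF k, of n] Suc.prems by (simp add: Op_def)
    moreover have "card (g ` (Op - {d})) \<le> card (Op - {d})"
      using fin by (intro card_image_le) auto
    ultimately have "\<not> {..<k} \<subseteq> g ` (Op - {d})"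
      using card_mono[of "g ` (Op - {d})" "{..<k}"] fin by auto
    then obtain c where c: "c < k" "c \<notin> g ` (Op - {d})" by auto
    have old: "first_pos w d' < n" if "d' \<in> data_set" "first_pos w d' < Suc n" "d' \<noteq> d" for d'
      using that uniq by (auto simp: less_Suc_eq)
    \<comment> \<open>An older session that meets the one of \<open>d\<close> starts before
      \<open>n\<close> and reaches \<open>n\<close>, hence its datum is in
      \<open>Op\<close>.\<close>
    have new: "g d' \<noteq> c" if "d' \<in> data_set" "first_pos w d' < Suc n" "d' \<noteq> d" "first_pos w d \<le> last_pos w d'" for d'
      using c(2) that True by (auto simp: Op_def)
    show ?thesis
    proof (intro exI[of _ "g(d := c)"] ballI impI conjI)
      fix e assume e: "e \<in> data_set" "first_pos w e < Suc n"
      show "(g(d := c)) e < k" using e c(1) g(1) old by simp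
      fix e' assume e': "e' \<in> data_set" "first_pos w e' < Suc n" "e \<noteq> e'"
        "first_pos w e \<le> last_pos w e'" "first_pos w e' \<le> last_pos w e"
      consider "e = d" | "e' = d" | "e \<noteq> d" "e' \<noteq> d" by blast
      then show "(g(d := c)) e \<noteq> (g(d := c)) e'"
      proof cases
        case 1
        then show ?thesis using new[of e'] e' by auto
      next
        case 2
        then show ?thesis using new[of e] e e' by auto
      next
        case 3
        then show ?thesis using g(2)[of e e'] old e e' by auto
      qed
    qed
  qed
qed simp

lemma k_bounded_imp_reg_ops:
  assumes "k_bounded k w"
  shows "\<exists>\<rho>. \<forall>j<length w. reg (\<rho> j) < k \<and> op_ok \<rho> w j"
proof -
  obtain g where g: "\<And>d. d \<in> data_set \<Longrightarrow> g d < k"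
    "\<And>d d'. d \<in> data_set \<Longrightarrow> d' \<in> data_set \<Longrightarrow> d \<noteq> d' \<Longrightarrow>
      first_pos w d \<le> last_pos w d' \<Longrightarrow> first_pos w d' \<le> last_pos w d \<Longrightarrow> g d \<noteq> g d'"
    using exists_colouring[OF assms order_refl] data_at_first_pos(1) by metis
  \<comment> \<open>Each datum keeps its colour as its register throughout its session and is
    introduced as fresh at its first position.\<close>
  define \<rho> where "\<rho> i = (if first_pos w (data_at w i) = i then Fresh (g (data_at w i))
    else Reuse (g (data_at w i)))" for i
  have reg: "reg (\<rho> i) = g (data_at w i)" for i by (simp add: \<rho>_def)
  have in_set: "data_at w i \<in> data_set" if "i < length w" for i
    using that by (simp add: positions_def)
  have "op_ok \<rho> w j" if j: "j < length w" for j
  proof (cases "first_pos w (data_at w j) = j")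
    case True
    have "data_at w i \<noteq> data_at w j" if "i < j" for i
      using first_pos_le[of i] that j True by auto
    then show ?thesis using True by (simp add: op_ok_def \<rho>_def)
  next
    case False
    define I where "I = {i. i < j \<and> data_at w i = data_at w j}"
    have "first_pos w (data_at w j) \<in> I"
      using False first_pos_le[OF j] data_at_first_pos(2)[OF in_set[OF j]] by (auto simp: I_def)
    moreover have fin: "finite I" by (simp add: I_def)
    ultimately have i: "Max I \<in> I" by (intro Max_in) auto
    \<comment> \<open>Here \<open>Max I\<close> is the previous occurrence of the datum at
      \<open>j\<close>. A position \<open>m\<close> strictly in between lies in the session of that
      datum and in that of its own datum, so the two colours differ.\<close>
    have "g (data_at w m) \<noteq> g (data_at w j)" if m: "Max I < m" "m < j" for m
    proof (rule g(2))
      have "m \<notin> I" using m(1) Max_ge[OF fin, of m] by auto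
      then show "data_at w m \<noteq> data_at w j" using m by (auto simp: I_def)
      show "first_pos w (data_at w m) \<le> last_pos w (data_at w j)"
        using first_pos_le[of m] le_last_pos[of j] m j by linarith
      have "first_pos w (data_at w j) \<le> Max I"
        using first_pos_le[of "Max I"] i j by (auto simp: I_def)
      then show "first_pos w (data_at w j) \<le> last_pos w (data_at w m)"
        using le_last_pos[of m] m j by linarith
    qed (use in_set m j in auto)
    then show ?thesis
      using False i reg unfolding op_ok_def by (auto simp: \<rho>_def[of j] I_def intro!: exI[of _ "Max I"])
  qed
  then show ?thesis using reg g(1) in_set by (intro exI[of _ \<rho>]) simp
qed

end

section \<open>Session automata from regular languages of symbolic words\<close>

lemma left_quotient_snoc: "left_quotient K (u @ [c]) = {v. c # v \<in> left_quotient K u}"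
  by (simp add: left_quotient_def)

lemma regular_imp_session_automaton:
  fixes K :: "('a::finite \<times> nat reg_op) list set"
  assumes "regular K" and "k > 0"
  shows "\<exists>A :: (nat, nat, 'a) session_aut. session_automaton A \<and>
    (aut_language A :: ('a, 'd) data_word set) =
      {w. \<exists>\<rho>. (\<forall>i<length w. reg (\<rho> i) < k \<and> op_ok \<rho> w i) \<and>
        map (\<lambda>i. (label_at w i, \<rho> i)) [0..<length w] \<in> K}"
proof -
  \<comment> \<open>The Myhill-Nerode automaton of \<open>K\<close>, restricted to letters with
    registers below \<open>k\<close>. These are finitely many because \<open>'a\<close> is finite,
    and \<open>k > 0\<close> keeps the register set non-empty.\<close>
  define A where "A = \<lparr>states = range (left_quotient K), registers = {..<k}, initial = K,
    finals = {Q \<in> range (left_quotient K). [] \<in> Q},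
    transitions = (\<lambda>(Q, c). (Q, c, {v. c # v \<in> Q})) `
      (range (left_quotient K) \<times> UNIV \<times> (Fresh ` {..<k} \<union> Reuse ` {..<k}))\<rparr>"
  have ops: "p \<in> Fresh ` {..<k} \<union> Reuse ` {..<k} \<longleftrightarrow> reg p < k" for p
    by (cases p) auto
  have init: "K = left_quotient K []" by (simp add: left_quotient_def)
  have trans: "(Q, (a, p), Q') \<in> transitions A \<longleftrightarrow>
      Q \<in> range (left_quotient K) \<and> reg p < k \<and> Q' = {v. (a, p) # v \<in> Q}" for Q a p Q'
    unfolding A_def using ops by (auto simp: image_iff)
  have next_state: "{v. c # v \<in> Q} \<in> range (left_quotient K)" if "Q \<in> range (left_quotient K)" for Q c
    using that by (auto simp flip: left_quotient_snoc)
  have "finite (transitions A)"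
    using assms(1) by (simp add: A_def regular_def)
  then have aut: "session_automaton A"
    using assms init next_state trans
    unfolding session_automaton_def by (auto simp: A_def regular_def)
  have "w \<in> aut_language A \<longleftrightarrow> (\<exists>\<rho>. (\<forall>i<length w. reg (\<rho> i) < k \<and> op_ok \<rho> w i) \<and>
      map (\<lambda>i. (label_at w i, \<rho> i)) [0..<length w] \<in> K)" (is "_ \<longleftrightarrow> ?R") for w :: "('a, 'd) data_word"
  proof
    assume "w \<in> aut_language A"
    then obtain \<rho> \<sigma> where tr: "run_trace A \<rho> \<sigma> w (length w)" and fin: "\<sigma> (length w) \<in> finals A"
      by (auto simp: aut_language_iff_trace)
    \<comment> \<open>The state sequence is forced: after a prefix the state is the quotient by that
      prefix, so a final state means that the whole symbolic word is in \<open>K\<close>.\<close>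
    have "\<sigma> i = left_quotient K (map (\<lambda>i. (label_at w i, \<rho> i)) [0..<i])" if "i \<le> length w" for i
      using that
    proof (induction i)
      case 0
      then show ?case using tr by (simp add: run_trace_def A_def left_quotient_def)
    next
      case (Suc i)
      then show ?case using tr by (auto simp: run_trace_def trans left_quotient_snoc)
    qed
    from this[of "length w"] fin tr show ?R
      by (intro exI[of _ \<rho>]) (auto simp: A_def left_quotient_def run_trace_def trans[unfolded A_def])
  next
    assume ?R
    then obtain \<rho> where \<rho>: "\<forall>i<length w. reg (\<rho> i) < k \<and> op_ok \<rho> w i"
      "map (\<lambda>i. (label_at w i, \<rho> i)) [0..<length w] \<in> K" by blast
    define \<sigma> where "\<sigma> i = left_quotient K (map (\<lambda>i. (label_at w i, \<rho> i)) [0..<i])" for i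
    have "run_trace A \<rho> \<sigma> w (length w)"
      using \<rho>(1) init by (auto simp: run_trace_def trans \<sigma>_def left_quotient_snoc A_def[THEN arg_cong, of initial])
    moreover have "\<sigma> (length w) \<in> finals A"
      using \<rho>(2) by (auto simp: A_def \<sigma>_def left_quotient_def)
    ultimately show "w \<in> aut_language A" by (auto simp: aut_language_iff_trace)
  qed
  then have "(aut_language A :: ('a, 'd) data_word set) =
      {w. \<exists>\<rho>. (\<forall>i<length w. reg (\<rho> i) < k \<and> op_ok \<rho> w i) \<and>
        map (\<lambda>i. (label_at w i, \<rho> i)) [0..<length w] \<in> K}" by blast
  \<comment> \<open>The states are sets of words; they are renamed to natural numbers.\<close>
  then show ?thesis using session_automaton_nat[OF aut, where ?'d = 'd] by auto
qed

section \<open>From session automata to formulas\<close>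

definition Conj :: "'a dmso \<Rightarrow> 'a dmso \<Rightarrow> 'a dmso" where
  "Conj f g = Neg (Disj (Neg f) (Neg g))"

definition Imp :: "'a dmso \<Rightarrow> 'a dmso \<Rightarrow> 'a dmso" where
  "Imp f g = Disj (Neg f) g"

definition All1 :: "nat \<Rightarrow> 'a dmso \<Rightarrow> 'a dmso" where
  "All1 x f = Neg (Ex1 x (Neg f))"

definition All2 :: "nat \<Rightarrow> 'a dmso \<Rightarrow> 'a dmso" where
  "All2 X f = Neg (Ex2 X (Neg f))"

text \<open>A closed formula that is also correct on the empty word, where every first-order
  existential fails.\<close>

definition Truth :: "bool \<Rightarrow> 'a dmso" where
  "Truth b = (if b then Neg (Ex1 0 (Neg (EqPos 0 0))) else Ex1 0 (Neg (EqPos 0 0)))"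

definition Disjs :: "'a dmso list \<Rightarrow> 'a dmso" where
  "Disjs fs = foldr Disj fs (Truth False)"

definition Conjs :: "'a dmso list \<Rightarrow> 'a dmso" where
  "Conjs fs = Neg (Disjs (map Neg fs))"

fun Ex2s :: "nat \<Rightarrow> 'a dmso \<Rightarrow> 'a dmso" where
  "Ex2s 0 f = f"
| "Ex2s (Suc n) f = Ex2 n (Ex2s n f)"

lemma sat_derived [simp]:
  "sat w v V (Conj f g) \<longleftrightarrow> sat w v V f \<and> sat w v V g"
  "sat w v V (Imp f g) \<longleftrightarrow> (sat w v V f \<longrightarrow> sat w v V g)"
  "sat w v V (All1 x f) \<longleftrightarrow> (\<forall>i\<in>positions w. sat w (v(x := i)) V f)"
  "sat w v V (All2 X f) \<longleftrightarrow> (\<forall>I. I \<subseteq> positions w \<longrightarrow> sat w v (V(X := I)) f)"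
  "sat w v V (Truth b) \<longleftrightarrow> b"
  by (auto simp: Conj_def Imp_def All1_def All2_def Truth_def)

lemma sat_Disjs [simp]: "sat w v V (Disjs fs) \<longleftrightarrow> (\<exists>f\<in>set fs. sat w v V f)"
  by (induction fs) (auto simp: Disjs_def)

lemma sat_Conjs [simp]: "sat w v V (Conjs fs) \<longleftrightarrow> (\<forall>f\<in>set fs. sat w v V f)"
  by (auto simp: Conjs_def)

lemma sat_Ex2s:
  "sat w v V (Ex2s n f) \<longleftrightarrow>
    (\<exists>V'. (\<forall>i<n. V' i \<subseteq> positions w) \<and> (\<forall>i\<ge>n. V' i = V i) \<and> sat w v V' f)"
proof (induction n arbitrary: V)
  case 0
  have "V' = V" if "\<forall>i. V' i = V i" for V' using that by auto
  then show ?case by auto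
next
  case (Suc n)
  show ?case (is "?L \<longleftrightarrow> ?R")
  proof
    assume ?L
    then obtain I V' where "I \<subseteq> positions w" "\<forall>i<n. V' i \<subseteq> positions w"
      "\<forall>i\<ge>n. V' i = (V(n := I)) i" "sat w v V' f"
      using Suc by auto
    then show ?R by (intro exI[of _ V']) (auto simp: less_Suc_eq)
  next
    assume ?R
    then obtain V' where V': "\<forall>i<Suc n. V' i \<subseteq> positions w" "\<forall>i\<ge>Suc n. V' i = V i" "sat w v V' f"
      by auto
    then have "\<forall>i\<ge>n. V' i = (V(n := V' n)) i" by (auto simp: Suc_le_eq)
    moreover have "\<forall>i<n. V' i \<subseteq> positions w" using V'(1) by simp
    ultimately have "sat w v (V(n := V' n)) (Ex2s n f)"
      unfolding Suc.IH using V'(3) by blast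
    then show ?L using V'(1) by auto
  qed
qed

lemma free1_derived [simp]:
  "free1 (Conj f g) = free1 f \<union> free1 g" "free1 (Imp f g) = free1 f \<union> free1 g"
  "free1 (All1 x f) = free1 f - {x}" "free1 (All2 X f) = free1 f" "free1 (Truth b) = {}"
  by (auto simp: Conj_def Imp_def All1_def All2_def Truth_def)

lemma free2_derived [simp]:
  "free2 (Conj f g) = free2 f \<union> free2 g" "free2 (Imp f g) = free2 f \<union> free2 g"
  "free2 (All1 x f) = free2 f" "free2 (All2 X f) = free2 f - {X}" "free2 (Truth b) = {}"
  by (auto simp: Conj_def Imp_def All1_def All2_def Truth_def)

lemma free_Disjs [simp]:
  "free1 (Disjs fs) = \<Union>(free1 ` set fs)" "free2 (Disjs fs) = \<Union>(free2 ` set fs)"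
  by (induction fs) (auto simp: Disjs_def)

lemma free_Conjs [simp]:
  "free1 (Conjs fs) = \<Union>(free1 ` set fs)" "free2 (Conjs fs) = \<Union>(free2 ` set fs)"
  by (auto simp: Conjs_def)

lemma free_Ex2s [simp]:
  "free1 (Ex2s n f) = free1 f" "free2 (Ex2s n f) = free2 f - {..<n}"
  by (induction n) (auto simp: less_Suc_eq)

text \<open>The order as reflexive transitive closure of successor, in its second-order form.
  \<open>x\<close> and \<open>y\<close> occur outside the scope of the inner first-order
  quantifiers, so they may be 0 or 1 without capture.\<close>

definition Le :: "nat \<Rightarrow> nat \<Rightarrow> 'a dmso" where
  "Le x y = All2 0 (Imp
    (Conj (Mem x 0) (All1 0 (All1 1 (Imp (Conj (Mem 0 0) (SuccPos 0 1)) (Mem 1 0))))) (Mem y 0))"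

definition Lt :: "nat \<Rightarrow> nat \<Rightarrow> 'a dmso" where
  "Lt x y = Neg (Le y x)"

lemma free_Lt [simp]: "free1 (Lt x y) = {x, y}" "free2 (Lt x y) = {}"
  by (auto simp: Lt_def Le_def)

lemma sat_Le:
  assumes "v x < length w" and "v y < length w"
  shows "sat w v V (Le x y) \<longleftrightarrow> v x \<le> v y"
proof
  assume "sat w v V (Le x y)"
  then have "\<And>I. I \<subseteq> positions w \<Longrightarrow> v x \<in> I \<Longrightarrow> (\<forall>i j. i \<in> positions w \<longrightarrow> j \<in> positions w \<longrightarrow>
      i \<in> I \<longrightarrow> j = Suc i \<longrightarrow> j \<in> I) \<Longrightarrow> v y \<in> I"
    by (auto simp: Le_def)
  \<comment> \<open>The final segment from \<open>v x\<close> is closed under successor within the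
    word.\<close>
  from this[of "{v x..<length w}"] show "v x \<le> v y"
    using assms by (auto simp: positions_def subset_iff)
next
  assume le: "v x \<le> v y"
  have "v y \<in> I" if "v x \<in> I" and I: "\<forall>i j. i < length w \<longrightarrow> j < length w \<longrightarrow> i \<in> I \<longrightarrow> j = Suc i \<longrightarrow> j \<in> I" for I
  proof -
    have "n < length w \<longrightarrow> n \<in> I" if "v x \<le> n" for n
      using that
    proof (induction n rule: dec_induct)
      case base
      show ?case using \<open>v x \<in> I\<close> by simp
    next
      case (step n)
      then show ?case using I by auto
    qed
    then show ?thesis using le assms by auto
  qed
  then show "sat w v V (Le x y)" by (auto simp: Le_def positions_def)
qed

lemma sat_Lt [simp]:
  "v x < length w \<Longrightarrow> v y < length w \<Longrightarrow> sat w v V (Lt x y) \<longleftrightarrow> v x < v y"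
  by (simp add: Lt_def sat_Le not_le)

section \<open>Formulas describing an accepting run\<close>

type_synonym ('s, 'r, 'a) transition = "'s \<times> ('a \<times> 'r reg_op) \<times> 's"

abbreviation "source t \<equiv> fst t"
abbreviation "target t \<equiv> snd (snd t)"
abbreviation "trans_label t \<equiv> fst (fst (snd t))"
abbreviation "trans_op t \<equiv> snd (fst (snd t))"

text \<open>The set variable \<open>i\<close> holds the positions at which the run takes the \<open>i\<close>-th transition.
  \<open>At ts x g\<close> says that the transition \<open>t\<close> taken at \<open>x\<close> satisfies \<open>g t\<close>.\<close>

definition At :: "'t list \<Rightarrow> nat \<Rightarrow> ('t \<Rightarrow> 'a dmso) \<Rightarrow> 'a dmso" where
  "At ts x g = Disjs (map (\<lambda>i. Conj (Mem x i) (g (ts ! i))) [0..<length ts])"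

definition Unique :: "nat \<Rightarrow> 'a dmso" where
  "Unique m = Disjs (map (\<lambda>i. Conj (Mem 0 i)
    (Conjs (map (\<lambda>j. Neg (Mem 0 j)) (filter (\<lambda>j. j \<noteq> i) [0..<m])))) [0..<m])"

text \<open>A transcription of \<open>op_ok\<close>: variable 0 is the current position, 1 an
  earlier one, and 2 ranges over the positions in between.\<close>

definition Op :: "('s, 'r, 'a) transition list \<Rightarrow> 'r reg_op \<Rightarrow> 'a dmso" where
  "Op ts p = (case p of
      Fresh r \<Rightarrow> All1 1 (Imp (Lt 1 0) (Neg (SameData 1 0)))
    | Reuse r \<Rightarrow> Ex1 1 (Conj (Lt 1 0) (Conj (At ts 1 (\<lambda>t. Truth (reg (trans_op t) = r)))
        (Conj (All1 2 (Imp (Conj (Lt 1 2) (Lt 2 0)) (At ts 2 (\<lambda>t. Truth (reg (trans_op t) \<noteq> r)))))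
          (SameData 1 0)))))"

text \<open>Variable 0 is the current position. The two disjunctions impose the initial and final
  states only at a position without predecessor or without successor; the universal formula links
  adjacent transitions.\<close>

definition Step :: "('s, 'r, 'a) session_aut \<Rightarrow> ('s, 'r, 'a) transition list \<Rightarrow>
    ('s, 'r, 'a) transition \<Rightarrow> 'a dmso" where
  "Step A ts t = Conjs [
      Label 0 (trans_label t),
      Disj (Ex1 1 (SuccPos 1 0)) (Truth (source t = initial A)),
      Disj (Ex1 1 (SuccPos 0 1)) (Truth (target t \<in> finals A)),
      All1 1 (Imp (SuccPos 0 1) (At ts 1 (\<lambda>t'. Truth (target t = source t')))),
      Op ts (trans_op t)]"

definition Run :: "('s, 'r, 'a) session_aut \<Rightarrow> ('s, 'r, 'a) transition list \<Rightarrow> 'a dmso" where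
  "Run A ts = All1 0 (At ts 0 (Step A ts))"

text \<open>On the empty word the first conjunct holds vacuously, so the second one decides that
  case by asking whether the initial state is final.\<close>

definition Accept :: "('s, 'r, 'a) session_aut \<Rightarrow> ('s, 'r, 'a) transition list \<Rightarrow> 'a dmso" where
  "Accept A ts = Conj (Ex2s (length ts) (Conj (All1 0 (Unique (length ts))) (Run A ts)))
    (Disj (Truth (initial A \<in> finals A)) (Ex1 0 (EqPos 0 0)))"

lemma free_At:
  "free1 (At ts x g) \<subseteq> {x} \<union> (\<Union>t\<in>set ts. free1 (g t))"
  "free2 (At ts x g) \<subseteq> {..<length ts} \<union> (\<Union>t\<in>set ts. free2 (g t))"
  by (auto simp: At_def intro!: bexI[OF _ nth_mem])

lemma free_At_Truth:
  "free1 (At ts x (\<lambda>t. Truth (P t))) \<subseteq> {x}" "free2 (At ts x (\<lambda>t. Truth (P t))) \<subseteq> {..<length ts}"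
  using free_At[of ts x "\<lambda>t. Truth (P t)"] by auto

lemma free_Op: "free1 (Op ts p) \<subseteq> {0}" "free2 (Op ts p) \<subseteq> {..<length ts}"
proof -
  note [simp] = subset_iff
  show "free1 (Op ts p) \<subseteq> {0}"
    using free_At_Truth(1)[of ts] by (cases p) (fastforce simp: Op_def)+
  show "free2 (Op ts p) \<subseteq> {..<length ts}"
    using free_At_Truth(2)[of ts] by (cases p) (fastforce simp: Op_def)+
qed

lemma free_Run: "free1 (Run A ts) = {}" "free2 (Run A ts) \<subseteq> {..<length ts}"
proof -
  have "free1 (Step A ts t) \<subseteq> {0}" "free2 (Step A ts t) \<subseteq> {..<length ts}" for t
    using free_At_Truth[of ts 1 "\<lambda>t'. target t = source t'"] free_Op[of ts "trans_op t"]
    by (auto simp: Step_def)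
  then show "free1 (Run A ts) = {}" "free2 (Run A ts) \<subseteq> {..<length ts}"
    using free_At[of ts 0 "Step A ts"] unfolding Run_def free1_derived free2_derived by blast+
qed

lemma sentence_Accept: "sentence (Accept A ts)"
proof -
  have "free1 (Unique m) \<subseteq> {0}" "free2 (Unique m) \<subseteq> {..<m}" for m
    by (auto simp: Unique_def)
  then show ?thesis
    using free_Run[of A ts] by (auto simp: sentence_def Accept_def)
qed

lemma sat_Unique:
  "sat w v V (Unique m) \<longleftrightarrow> (\<exists>i<m. \<forall>j<m. v 0 \<in> V j \<longleftrightarrow> i = j)"
proof -
  have "sat w v V (Unique m) \<longleftrightarrow> (\<exists>i<m. v 0 \<in> V i \<and> (\<forall>j<m. j \<noteq> i \<longrightarrow> v 0 \<notin> V j))"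
    by (auto simp: Unique_def)
  moreover have "v 0 \<in> V i \<and> (\<forall>j<m. j \<noteq> i \<longrightarrow> v 0 \<notin> V j) \<longleftrightarrow> (\<forall>j<m. v 0 \<in> V j \<longleftrightarrow> i = j)"
    if "i < m" for i
    using that by blast
  ultimately show ?thesis by (simp cong: conj_cong)
qed

text \<open>The semantic counterpart of \<open>Run\<close>: \<open>\<tau> i\<close> is the index in
  \<open>ts\<close> of the transition taken at position \<open>i\<close>.\<close>

definition accepts_via where
  "accepts_via A ts w \<tau> \<longleftrightarrow> (\<forall>i<length w. trans_label (ts ! \<tau> i) = label_at w i \<and>
    (i = 0 \<longrightarrow> source (ts ! \<tau> i) = initial A) \<and> (Suc i = length w \<longrightarrow> target (ts ! \<tau> i) \<in> finals A) \<and>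
    (Suc i < length w \<longrightarrow> target (ts ! \<tau> i) = source (ts ! \<tau> (Suc i))) \<and>
    op_ok (\<lambda>i. trans_op (ts ! \<tau> i)) w i)"

section \<open>The run formula under set variables given by a choice of transitions\<close>

context
  fixes w :: "('a, 'd) data_word" and V :: "nat \<Rightarrow> nat set" and \<tau> :: "nat \<Rightarrow> nat"
    and ts :: "('s, 'r, 'a) transition list"
  assumes \<tau>: "\<And>i. i < length w \<Longrightarrow> \<tau> i < length ts"
    and V: "\<And>i j. i < length w \<Longrightarrow> j < length ts \<Longrightarrow> i \<in> V j \<longleftrightarrow> \<tau> i = j"
begin

lemma sat_At: "v x < length w \<Longrightarrow> sat w v V (At ts x g) \<longleftrightarrow> sat w v V (g (ts ! \<tau> (v x)))"
  using \<tau> V by (auto simp: At_def)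

lemma sat_Op:
  assumes "j < length w" and "v 0 = j"
  shows "sat w v V (Op ts (trans_op (ts ! \<tau> j))) \<longleftrightarrow> op_ok (\<lambda>i. trans_op (ts ! \<tau> i)) w j"
proof (cases "trans_op (ts ! \<tau> j)")
  case (Fresh r)
  then show ?thesis using assms
    by (auto simp: Op_def op_ok_def positions_def)
next
  case (Reuse r)
  then show ?thesis using assms
    by (auto simp: Op_def op_ok_def positions_def sat_At)
qed

lemma sat_Run:
  "sat w v V (Run A ts) \<longleftrightarrow> accepts_via A ts w \<tau>"
proof -
  have "sat w v V (Run A ts) \<longleftrightarrow> (\<forall>i<length w. trans_label (ts ! \<tau> i) = label_at w i \<and>
    ((\<exists>j<length w. i = Suc j) \<or> source (ts ! \<tau> i) = initial A) \<and>
    ((\<exists>j<length w. j = Suc i) \<or> target (ts ! \<tau> i) \<in> finals A) \<and>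
    (\<forall>j<length w. j = Suc i \<longrightarrow> target (ts ! \<tau> i) = source (ts ! \<tau> j)) \<and>
    op_ok (\<lambda>i. trans_op (ts ! \<tau> i)) w i)"
    by (auto simp: Run_def Step_def sat_At sat_Op positions_def)
  moreover have "(\<exists>j<length w. i = Suc j) \<longleftrightarrow> i \<noteq> 0" if "i < length w" for i
    using that by (cases i) auto
  moreover have "(\<exists>j<length w. j = Suc i) \<longleftrightarrow> Suc i \<noteq> length w" if "i < length w" for i
    using that by auto
  ultimately show ?thesis unfolding accepts_via_def by (simp cong: conj_cong imp_cong) blast
qed

end

lemma sat_Accept:
  "sat w v V (Accept A ts) \<longleftrightarrow>
    (\<exists>\<tau>. (\<forall>i<length w. \<tau> i < length ts) \<and> accepts_via A ts w \<tau>) \<and>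
    (w = [] \<longrightarrow> initial A \<in> finals A)" (is "_ \<longleftrightarrow> (\<exists>\<tau>. ?run \<tau>) \<and> _")
proof -
  have "sat w v V (Ex2s (length ts) (Conj (All1 0 (Unique (length ts))) (Run A ts))) \<longleftrightarrow> (\<exists>\<tau>. ?run \<tau>)"
    (is "?L \<longleftrightarrow> ?R")
  proof
    assume ?L
    then obtain V' where V': "\<forall>p\<in>positions w. \<exists>i<length ts. \<forall>j<length ts. p \<in> V' j \<longleftrightarrow> i = j"
      "sat w v V' (Run A ts)"
      by (auto simp: sat_Ex2s sat_Unique)
    \<comment> \<open>\<open>Unique\<close> makes the set variables the level sets of a
      function.\<close>
    then obtain \<tau> where \<tau>: "\<And>p. p < length w \<Longrightarrow> \<tau> p < length ts"
      "\<And>p j. p < length w \<Longrightarrow> j < length ts \<Longrightarrow> p \<in> V' j \<longleftrightarrow> \<tau> p = j"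
      unfolding positions_def by (metis lessThan_iff)
    have "sat w v V' (Run A ts) \<longleftrightarrow> accepts_via A ts w \<tau>"
      by (rule sat_Run) (use \<tau> in auto)
    with V'(2) \<tau>(1) have "?run \<tau>" by blast
    then show ?R by blast
  next
    assume ?R
    then obtain \<tau> where \<tau>: "?run \<tau>" by blast
    \<comment> \<open>The level sets of \<open>\<tau>\<close>; variables from
      \<open>length ts\<close> on keep their value, as \<open>sat_Ex2s\<close> requires.\<close>
    define V' where "V' i = (if i < length ts then {p \<in> positions w. \<tau> p = i} else V i)" for i
    have V': "p \<in> V' j \<longleftrightarrow> \<tau> p = j" if "p < length w" "j < length ts" for p j
      using that by (simp add: V'_def positions_def)
    have lt: "\<And>p. p < length w \<Longrightarrow> \<tau> p < length ts" using \<tau> by blast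
    have "sat w v V' (Run A ts) \<longleftrightarrow> accepts_via A ts w \<tau>"
      by (rule sat_Run) (use lt V' in auto)
    with \<tau> have "sat w v V' (Run A ts)" by blast
    moreover have "sat w v V' (All1 0 (Unique (length ts)))"
      using lt V' by (auto simp: sat_Unique positions_def)
    ultimately show ?L
      unfolding sat_Ex2s by (intro exI[of _ V']) (auto simp: V'_def)
  qed
  then show ?thesis by (auto simp: Accept_def positions_def)
qed

lemma session_automaton_imp_dmso:
  assumes "session_automaton A"
  shows "\<exists>f. sentence f \<and> dmso_language f = (aut_language A :: ('a, 'd) data_word set)"
proof -
  \<comment> \<open>Listing the transitions assigns each one a set variable.\<close>
  obtain ts where ts: "set ts = transitions A"
    using assms finite_list[of "transitions A"] unfolding session_automaton_def by blast
  have "w \<in> aut_language A \<longleftrightarrow> sat w v V (Accept A ts)" for w :: "('a, 'd) data_word" and v V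
  proof
    assume "w \<in> aut_language A"
    then obtain \<rho> \<sigma> where tr: "run_trace A \<rho> \<sigma> w (length w)" "\<sigma> (length w) \<in> finals A"
      by (auto simp: aut_language_iff_trace)
    then have "\<forall>i<length w. \<exists>j<length ts. ts ! j = (\<sigma> i, (label_at w i, \<rho> i), \<sigma> (Suc i))"
      unfolding run_trace_def by (metis in_set_conv_nth ts)
    then obtain \<tau> where \<tau>: "\<And>i. i < length w \<Longrightarrow> \<tau> i < length ts \<and>
        ts ! \<tau> i = (\<sigma> i, (label_at w i, \<rho> i), \<sigma> (Suc i))"
      by metis
    have "op_ok (\<lambda>i. trans_op (ts ! \<tau> i)) w i = op_ok \<rho> w i" if "i < length w" for i
      by (rule op_ok_cong) (use \<tau> that in auto)
    then show "sat w v V (Accept A ts)"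
      unfolding sat_Accept using tr \<tau> by (intro conjI exI[of _ \<tau>]) (auto simp: run_trace_def accepts_via_def)
  next
    assume "sat w v V (Accept A ts)"
    then obtain \<tau> where \<tau>: "\<And>i. i < length w \<Longrightarrow> \<tau> i < length ts \<and> trans_label (ts ! \<tau> i) = label_at w i \<and>
      (i = 0 \<longrightarrow> source (ts ! \<tau> i) = initial A) \<and> (Suc i = length w \<longrightarrow> target (ts ! \<tau> i) \<in> finals A) \<and>
      (Suc i < length w \<longrightarrow> target (ts ! \<tau> i) = source (ts ! \<tau> (Suc i))) \<and>
      op_ok (\<lambda>i. trans_op (ts ! \<tau> i)) w i"
      and Nil: "w = [] \<longrightarrow> initial A \<in> finals A"
      unfolding sat_Accept accepts_via_def by blast
    \<comment> \<open>Every state but the first is the target of the preceding transition; on the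
      empty word the sequence ends in the initial state.\<close>
    define \<sigma> where "\<sigma> i = (case i of 0 \<Rightarrow> initial A | Suc j \<Rightarrow> target (ts ! \<tau> j))" for i
    have src: "source (ts ! \<tau> i) = \<sigma> i" if "i < length w" for i
      using that \<tau>[of i] \<tau>[of "i - 1"] by (cases i) (auto simp: \<sigma>_def)
    have "(\<sigma> i, (label_at w i, trans_op (ts ! \<tau> i)), \<sigma> (Suc i)) = ts ! \<tau> i" if "i < length w" for i
      using that \<tau>[of i] src[of i] by (auto simp: \<sigma>_def prod_eq_iff)
    then have "(\<sigma> i, (label_at w i, trans_op (ts ! \<tau> i)), \<sigma> (Suc i)) \<in> transitions A" if "i < length w" for i
      using that \<tau>[of i] ts nth_mem by metis
    then have "run_trace A (\<lambda>i. trans_op (ts ! \<tau> i)) \<sigma> w (length w)"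
      using \<tau> by (auto simp: run_trace_def \<sigma>_def)
    moreover have "\<sigma> (length w) \<in> finals A"
      using Nil \<tau>[of "length w - 1"] by (cases w) (auto simp: \<sigma>_def)
    ultimately show "w \<in> aut_language A" by (auto simp: aut_language_iff_trace)
  qed
  then have "dmso_language (Accept A ts) = (aut_language A :: ('a, 'd) data_word set)"
    by (auto simp: dmso_language_def)
  then show ?thesis using sentence_Accept by blast
qed

section \<open>The characterization\<close>

text \<open>Boundedness provides each model with a legal encoding, and the truth of \<open>f\<close>
  does not depend on which legal encoding of a word is read.\<close>

lemma bounded_dmso_imp_session_automaton:
  fixes f :: "'a::finite dmso"
  assumes "sentence f" and bounded: "\<And>w :: ('a, 'd) data_word. w \<in> dmso_language f \<Longrightarrow> k_bounded k w"
  shows "\<exists>A :: (nat, nat, 'a) session_aut. session_automaton A \<and>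
    (aut_language A :: ('a, 'd) data_word set) = dmso_language f"
proof -
  \<comment> \<open>\<open>Suc k\<close> registers are used because \<open>k\<close> may be 0 and
    the register set must be non-empty.\<close>
  obtain K :: "'a track list set" where K: "regular K" "\<And>e (w :: ('a, 'd) data_word) v V.
      encodes (Suc k) e w \<Longrightarrow> marks (free1 f) (free2 f) e v V \<Longrightarrow> e \<in> K \<longleftrightarrow> sat w v V f"
    using recognizable[of "Suc k" f, where ?'d = 'd] unfolding recognizable_def by blast
  \<comment> \<open>A sentence has no free variables, so symbolic letters become track letters with
    empty marks.\<close>
  let ?track = "\<lambda>c. (c, {}, {}) :: 'a track"
  obtain A :: "(nat, nat, 'a) session_aut" where A: "session_automaton A"
    "(aut_language A :: ('a, 'd) data_word set) =
      {w. \<exists>\<rho>. (\<forall>i<length w. reg (\<rho> i) < Suc k \<and> op_ok \<rho> w i) \<and>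
        map (\<lambda>i. (label_at w i, \<rho> i)) [0..<length w] \<in> {u. map ?track u \<in> K}}"
    using regular_imp_session_automaton[OF regular_vimage_map[OF K(1), of ?track],
        of "Suc k", where ?'d = 'd] by blast
  have K_iff: "map (\<lambda>i. (label_at w i, \<rho> i)) [0..<length w] \<in> {u. map ?track u \<in> K} \<longleftrightarrow>
      w \<in> dmso_language f"
    if \<rho>: "\<forall>i<length w. reg (\<rho> i) < Suc k \<and> op_ok \<rho> w i" for w :: "('a, 'd) data_word" and \<rho>
  proof -
    define e where "e = map ?track (map (\<lambda>i. (label_at w i, \<rho> i)) [0..<length w])"
    have e: "length e = length w" "\<And>i. i < length w \<Longrightarrow> e ! i = ((label_at w i, \<rho> i), {}, {})"
      by (simp_all add: e_def)
    have "op_ok (\<lambda>i. track_op (e ! i)) w j = op_ok \<rho> w j" if "j < length w" for j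
      by (rule op_ok_cong) (use e that in auto)
    then have "encodes (Suc k) e w" using \<rho> e by (simp add: encodes_def)
    moreover have "marks (free1 f) (free2 f) e v V" for v V
      using assms(1) by (simp add: sentence_def marks_def)
    ultimately have "e \<in> K \<longleftrightarrow> sat w v V f" for v V using K(2) by blast
    then show ?thesis by (auto simp: dmso_language_def e_def)
  qed
  have "w \<in> aut_language A \<longleftrightarrow> w \<in> dmso_language f" for w :: "('a, 'd) data_word"
  proof
    assume "w \<in> aut_language A"
    then show "w \<in> dmso_language f" unfolding A(2) using K_iff by blast
  next
    assume w: "w \<in> dmso_language f"
    then obtain \<rho> where "\<forall>i<length w. reg (\<rho> i) < k \<and> op_ok \<rho> w i"
      using k_bounded_imp_reg_ops[OF bounded] by blast
    then have "\<forall>i<length w. reg (\<rho> i) < Suc k \<and> op_ok \<rho> w i" using less_SucI by blast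
    then show "w \<in> aut_language A" unfolding A(2) using K_iff w by blast
  qed
  then show ?thesis using A(1) by blast
qed

theorem theorem4p1:
  fixes L :: "('a::finite, 'd) data_word set"
  assumes "infinite (UNIV :: 'd set)"
    and "bounded_data_language L"
  shows "(\<exists>A :: (nat, nat, 'a) session_aut. session_automaton A \<and> aut_language A = L) \<longleftrightarrow>
         (\<exists>\<phi> :: 'a dmso. sentence \<phi> \<and> dmso_language \<phi> = L)"
proof
  assume "\<exists>A :: (nat, nat, 'a) session_aut. session_automaton A \<and> aut_language A = L"
  then show "\<exists>\<phi> :: 'a dmso. sentence \<phi> \<and> dmso_language \<phi> = L"
    using session_automaton_imp_dmso by blast
next
  assume "\<exists>\<phi> :: 'a dmso. sentence \<phi> \<and> dmso_language \<phi> = L"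
  moreover obtain k where "\<And>w. w \<in> L \<Longrightarrow> k_bounded k w"
    using assms(2) by (auto simp: bounded_data_language_def)
  ultimately show "\<exists>A :: (nat, nat, 'a) session_aut. session_automaton A \<and> aut_language A = L"
    using bounded_dmso_imp_session_automaton by blast
qed

end
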